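(* Let $n>1$ and let $S,K\subset\mathbb{R}^n$ be two (closed, bounded) symmetric convex bodies. If the couple $(S,K)$ admits concentration, then every set $\Lambda\subset\mathbb{R}^n$ satisfying $(\Lambda-\Lambda)\cap 12K=\{0\}$ is an interpolation set for $PW_S$.
   Context: Fourier transform: $\hat F(t)=(2\pi)^{-n/2}\int_{\mathbb{R}^n}e^{-it\cdot x}F(x)\,dx$ (unitary on $L^2(\mathbb{R}^n)$). The couple $(S,K)$ admits concentration if there is a function $F\in L^2(\mathbb{R}^n)$ with $\|F\|_2=1$, $\|F\|_{L^2(K)}>\frac78$ and $\|\hat F\|_{L^2(S)}>\frac78$. $\Lambda-\Lambda=\{\lambda-\lambda':\lambda,\lambda'\in\Lambda\}$ and $12K=\{12x:x\in K\}$. Symmetric means symmetric about the origin. For a bounded set $S\subset\mathbb{R}^n$ of positive measure, the Paley--Wiener space $PW_S$ consists of all Fourier transforms $\hat F$ of functions $F\in L^2(\mathbb{R}^n)$ vanishing a.e. outside $S$ (its elements are continuous functions). A countable set $\Lambda$ is an interpolation set for $PW_S$ if for every $c\in\ell^2(\Lambda)$ there is $f\in PW_S$ with $f(\lambda)=c(\lambda)$ for all $\lambda\in\Lambda$. *)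

theory Defs
  imports "HOL-Analysis.Analysis"
begin

definition convex_body :: "'a::euclidean_space set \<Rightarrow> bool" where
  "convex_body K \<longleftrightarrow> convex K \<and> compact K \<and> interior K \<noteq> {}"

definition origin_symmetric :: "'a::euclidean_space set \<Rightarrow> bool" where
  "origin_symmetric K \<longleftrightarrow> (\<forall>x\<in>K. - x \<in> K)"

(* Elements of L2 are represented by Borel functions; every Lebesgue measurable function
   agrees almost everywhere with one of these. *)
definition sq_integrable :: "('a::euclidean_space \<Rightarrow> complex) \<Rightarrow> bool" where
  "sq_integrable F \<longleftrightarrow>
     F \<in> borel_measurable lborel \<and> integrable lborel (\<lambda>x. (norm (F x))\<^sup>2)"

(* Meaningful for sq_integrable F and Borel sets A only. *)
definition L2_norm_on :: "'a::euclidean_space set \<Rightarrow> ('a \<Rightarrow> complex) \<Rightarrow> real" where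
  "L2_norm_on A F = sqrt (LINT x:A|lborel. (norm (F x))\<^sup>2)"

(* The integral formula; by the convention for the Bochner integral it is 0 if F is not
   integrable. *)
definition fourier :: "('a::euclidean_space \<Rightarrow> complex) \<Rightarrow> 'a \<Rightarrow> complex" where
  "fourier F t =
     complex_of_real ((2 * pi) powr (- (real DIM('a) / 2))) *
     (LINT x|lborel. exp (- \<i> * complex_of_real (t \<bullet> x)) * F x)"

(* G is (a representative of) the Fourier-Plancherel transform of F: the limit in L2 of the
   transforms of the truncations of F to balls, which are integrable. The L2 distance is
   expressed by the nonnegative integral, so that it cannot vanish by convention. *)
definition has_L2_fourier ::
  "('a::euclidean_space \<Rightarrow> complex) \<Rightarrow> ('a \<Rightarrow> complex) \<Rightarrow> bool" where
  "has_L2_fourier F G \<longleftrightarrow> sq_integrable F \<and> sq_integrable G \<and>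
     ((\<lambda>R::real. \<integral>\<^sup>+ t. ennreal ((norm
         (fourier (\<lambda>x. indicator (cball 0 R) x * F x) t - G t))\<^sup>2) \<partial>lborel)
       \<longlongrightarrow> 0) at_top"

definition admits_concentration ::
  "'a::euclidean_space set \<Rightarrow> 'a set \<Rightarrow> bool" where
  "admits_concentration S K \<longleftrightarrow>
     (\<exists>F G. has_L2_fourier F G \<and> L2_norm_on UNIV F = 1 \<and>
        L2_norm_on K F > 7 / 8 \<and> L2_norm_on S G > 7 / 8)"

(* For bounded S such F are integrable, so the integral formula gives the continuous
   representative of the transform. *)
definition paley_wiener ::
  "'a::euclidean_space set \<Rightarrow> ('a \<Rightarrow> complex) set" where
  "paley_wiener S =
     {fourier F | F. sq_integrable F \<and> (AE x in lborel. x \<notin> S \<longrightarrow> F x = 0)}"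

definition interpolation_set ::
  "'a::euclidean_space set \<Rightarrow> ('a \<Rightarrow> complex) set \<Rightarrow> bool" where
  "interpolation_set \<Lambda> W \<longleftrightarrow> countable \<Lambda> \<and>
     (\<forall>c :: 'a \<Rightarrow> complex. (\<lambda>l. (norm (c l))\<^sup>2) summable_on \<Lambda> \<longrightarrow>
        (\<exists>f\<in>W. \<forall>l\<in>\<Lambda>. f l = c l))"

end

theory Submission
  imports Defs "HOL-Probability.Characteristic_Functions"
begin

text \<open>
  Let \<open>k\<close> be the restriction of the concentrated function \<open>F\<close> to \<open>K\<close> and \<open>\<Phi>\<close> its Fourier transform.
  The function \<open>F\<close> makes a small angle with \<open>k\<close>, and its transform makes a small angle with the functions
  carried by \<open>S\<close>; adding the two angles shows that \<open>S\<close> carries at least the part \<open>(17/32)\<^sup>2\<close> of the energy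
  of \<open>\<Phi>\<close> (\<open>concentrated_truncation\<close>). Let \<open>w\<close> be the density \<open>\<bar>\<Phi>\<bar>\<^sup>2\<close>, cut off to \<open>S\<close> and
  normalised to total mass one, \<open>\<rho>\<close> its Fourier transform and \<open>r = \<bar>\<rho>\<bar>\<^sup>2\<close>, so that \<open>r 0 = 1\<close>. Translates of \<open>k\<close> along a set \<open>X\<close>
  with disjoint \<open>x + K\<close> are orthogonal, and Bessel's inequality for them reads
  \<open>(\<Sum>x\<in>X. r x) \<le> (32/17)\<^sup>2 < 3.55\<close>.

  This bound does not exclude points \<open>x\<close> far from the origin at which \<open>r x\<close> is close to one. The translation
  structure does: if \<open>\<bar>\<rho> x\<bar>\<close> is nearly one, then so is \<open>\<bar>\<rho> (2 x)\<bar> \<ge> 2 \<bar>\<rho> x\<bar>\<^sup>2 - 1\<close>,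
  and Bessel's inequality for \<open>{0, \<plusminus>x, \<plusminus>2x}\<close> fails. Hence \<open>r x \<le> 5/6\<close> whenever \<open>x\<close> lies outside
  \<open>2 K\<close> (\<open>r_le\<close>). A polynomial of degree two now separates the value \<open>1\<close> from the interval \<open>[0, 5/6]\<close>:
  the Chebyshev polynomial \<open>T\<^sub>2 (y) = 2 y\<^sup>2 - 1\<close>, carried over to this interval, is at most one in modulus there
  and equals \<open>73/25\<close> at one. So \<open>p r = 25 r T\<^sub>2 (12 r / 5 - 1)\<close> satisfies \<open>p 1 = 73\<close>, whereas
  \<open>\<bar>p (r x)\<bar> \<le> 25 r x\<close> at all other points of a set whose translates of \<open>K\<close> are disjoint, with sum at most
  \<open>25 ((32/17)\<^sup>2 - 1) < 64\<close>.

  Each factor \<open>r = \<rho> \<rho>\<^sup>*\<close> has its spectrum in \<open>2 S\<close> and \<open>p\<close> is cubic, hence \<open>p \<circ> r\<close> has its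
  spectrum in \<open>6 S\<close>. The kernel \<open>\<phi> x = p (r (x / 6)) / 73\<close> therefore has its spectrum in \<open>S\<close>, and it is
  small in the above sense along every set whose differences meet \<open>2 \<sqdot> 6 K = 12 K\<close> only in \<open>0\<close>
  (\<open>interpolation_kernel\<close>). This is the origin of the constant.

  The matrix \<open>\<phi> (\<lambda> - \<mu>)\<close> is thus the identity up to an operator of norm at most \<open>64/73\<close> on \<open>\<ell>\<^sup>2\<close>
  (\<open>schur_test\<close>). Finite combinations of translates of \<open>\<phi>\<close> interpolate up to an error that is
  smaller by a fixed factor (\<open>approximate_interpolation\<close>), and the corrections, summed in \<open>L\<^sup>2 (S)\<close>,
  interpolate exactly (\<open>interpolation_from_kernel\<close>).

  The estimates between functions and their transforms rest on the inequality
  \<open>\<parallel>fourier f\<parallel>\<^sub>2 \<le> \<parallel>f\<parallel>\<^sub>2\<close> for integrable \<open>f\<close> (\<open>plancherel_le\<close>), proved with Gaussian weights.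
\<close>

section \<open>Gaussian integrals\<close>

lemma nn_integral_affine:
  fixes f :: "'a::euclidean_space \<Rightarrow> ennreal" and c :: real
  assumes [measurable]: "f \<in> borel_measurable borel" and "c \<noteq> 0"
  shows "(\<integral>\<^sup>+x. f x \<partial>lborel) = ennreal (\<bar>c\<bar> ^ DIM('a)) * (\<integral>\<^sup>+x. f (t + c *\<^sub>R x) \<partial>lborel)"
  by (subst lborel_affine[OF assms(2), of t])
     (simp add: nn_integral_density nn_integral_distr nn_integral_cmult)

lemma integrable_affine:
  fixes f :: "'a::euclidean_space \<Rightarrow> 'b::{banach, second_countable_topology}" and c :: real
  assumes f: "integrable lborel f" and c: "c \<noteq> 0"
  shows "integrable lborel (\<lambda>x. f (t + c *\<^sub>R x))"
  using f f[THEN borel_measurable_integrable] c unfolding integrable_iff_bounded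
  by (subst (asm) nn_integral_affine[where c=c and t=t]) (auto simp: ennreal_mult_less_top)

lemma integral_affine:
  fixes f :: "'a::euclidean_space \<Rightarrow> 'b::{banach, second_countable_topology}" and c :: real
  assumes [measurable]: "f \<in> borel_measurable borel" and c: "c \<noteq> 0"
  shows "(LINT x|lborel. f x) = \<bar>c\<bar> ^ DIM('a) *\<^sub>R (LINT x|lborel. f (t + c *\<^sub>R x))"
  by (subst lborel_affine[OF c, of t])
     (simp add: integral_density integral_distr)

text \<open>
  Lebesgue measure on a Euclidean space is the image of a product measure, so that Gaussian integrals
  reduce to one dimension.
\<close>

lemma
  fixes f :: "'a::euclidean_space \<Rightarrow> real \<Rightarrow> complex"
  assumes f: "\<And>b. b \<in> Basis \<Longrightarrow> integrable lborel (f b)"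
  shows integrable_prod_Basis: "integrable lborel (\<lambda>x::'a. \<Prod>b\<in>Basis. f b (x \<bullet> b))" (is ?I)
    and integral_prod_Basis: "(LINT x|lborel. (\<Prod>b\<in>Basis. f b ((x::'a) \<bullet> b))) = (\<Prod>b\<in>Basis. (LINT u|lborel. f b u))"
      (is ?E)
proof -
  have m[measurable]: "f b \<in> borel_measurable borel" if "b \<in> Basis" for b
    using f[OF that] by (simp add: integrable_iff_bounded)
  interpret product_sigma_finite "\<lambda>_::'a. lborel :: real measure" ..
  have i: "integrable (\<Pi>\<^sub>M b\<in>Basis. lborel) (\<lambda>x. \<Prod>b\<in>Basis. f b (x b))"
    by (rule product_integrable_prod) (auto intro: f)
  have c: "(\<Prod>b\<in>Basis. f b ((\<Sum>b\<in>Basis. x b *\<^sub>R b) \<bullet> b)) = (\<Prod>b\<in>Basis. f b (x b))" for x :: "'a \<Rightarrow> real"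
    by (intro prod.cong refl) (simp add: inner_sum_left_Basis)
  show ?I
    unfolding lborel_eq[where 'a='a]
    by (subst integrable_distr_eq) (use i c in simp_all)
  show ?E
    unfolding lborel_eq[where 'a='a]
    by (subst integral_distr) (use c in \<open>simp_all add: product_integral_prod f\<close>)
qed

text \<open>
  The characteristic function of the standard normal distribution, rescaled.
\<close>

lemma
  fixes \<sigma> z :: real
  assumes s: "\<sigma> > 0"
  shows integrable_gaussian_real: "integrable lborel (\<lambda>t. iexp (- (t * z)) * complex_of_real (exp (- (\<sigma>\<^sup>2 * t\<^sup>2 / 2))))" (is ?I)
   and fourier_gaussian_real: "(LINT t|lborel. iexp (- (t * z)) * complex_of_real (exp (- (\<sigma>\<^sup>2 * t\<^sup>2 / 2)))) =
       complex_of_real (sqrt (2 * pi) / \<sigma> * exp (- (z\<^sup>2 / (2 * \<sigma>\<^sup>2))))" (is ?E)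
proof -
  let ?g = "\<lambda>u. complex_of_real (std_normal_density u) * iexp ((-z/\<sigma>) * u)"
  have g: "(LINT u|lborel. ?g u) = complex_of_real (exp (- ((z/\<sigma>)\<^sup>2) / 2))"
    using char_std_normal_distribution[THEN fun_cong, of "-z/\<sigma>"]
    unfolding char_def by (subst (asm) integral_density) (auto simp: scaleR_conv_of_real)
  have gi: "integrable lborel ?g"
    by (rule Bochner_Integration.integrable_bound[OF integrable_normal_density[where \<mu>=0 and \<sigma>=1]]) (auto simp: norm_mult)
  have eq: "?g (0 + \<sigma> * t) = complex_of_real (1 / sqrt (2*pi)) * (iexp (- (t * z)) * complex_of_real (exp (- (\<sigma>\<^sup>2 * t\<^sup>2 / 2))))" for t
    using s by (simp add: std_normal_density_def power_mult_distrib mult_ac exp_minus inverse_eq_divide)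
  have "integrable lborel (\<lambda>t. complex_of_real (1 / sqrt (2*pi)) * (iexp (- (t * z)) * complex_of_real (exp (- (\<sigma>\<^sup>2 * t\<^sup>2 / 2)))))"
    using lborel_integrable_real_affine[OF gi, of \<sigma> 0] s unfolding eq by simp
  from integrable_mult_right[OF this, of "complex_of_real (sqrt (2*pi))"] show ?I
    unfolding mult.assoc[symmetric] of_real_mult[symmetric] by simp
  have "(LINT u|lborel. ?g u) = \<sigma> *\<^sub>R (LINT t|lborel. ?g (0 + \<sigma> * t))"
    by (subst lborel_integral_real_affine[where c=\<sigma> and t=0]) (use s in auto)
  also have "\<dots> = \<sigma> * complex_of_real (1 / sqrt (2*pi)) * (LINT t|lborel. (iexp (- (t * z)) * complex_of_real (exp (- (\<sigma>\<^sup>2 * t\<^sup>2 / 2)))))"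
    unfolding eq by (subst integral_mult_right_zero) (simp add: scaleR_conv_of_real)
  finally show ?E
    using s unfolding g by (simp add: field_simps power_divide)
qed

lemma
  fixes z :: "'a::euclidean_space" and \<sigma> :: real
  assumes s: "\<sigma> > 0"
  shows integrable_gaussian: "integrable lborel (\<lambda>t::'a. iexp (- (t \<bullet> z)) * complex_of_real (exp (- (\<sigma>\<^sup>2 * (t \<bullet> t) / 2))))" (is ?I)
   and fourier_gaussian: "(LINT t|lborel. iexp (- (t \<bullet> z)) * complex_of_real (exp (- (\<sigma>\<^sup>2 * (t \<bullet> t) / 2)))) =
       complex_of_real ((sqrt (2 * pi) / \<sigma>) ^ DIM('a) * exp (- ((z \<bullet> z) / (2 * \<sigma>\<^sup>2))))" (is ?E)
proof -
  define f where "f = (\<lambda>(b::'a) u. iexp (- (u * (z \<bullet> b))) * complex_of_real (exp (- (\<sigma>\<^sup>2 * u\<^sup>2 / 2))))"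
  have zz: "x \<bullet> y = (\<Sum>b\<in>Basis. (x \<bullet> b) * (y \<bullet> b))" for x y :: 'a
    by (rule euclidean_inner)
  have eq: "(\<Prod>b\<in>Basis. f b (t \<bullet> b)) = iexp (- (t \<bullet> z)) * complex_of_real (exp (- (\<sigma>\<^sup>2 * (t \<bullet> t) / 2)))" for t
  proof -
    have "(\<Prod>b\<in>Basis. iexp (- ((t \<bullet> b) * (z \<bullet> b)))) = iexp (- (t \<bullet> z))"
      unfolding zz[of t z] exp_sum[OF finite_Basis, symmetric] of_real_minus of_real_sum sum_negf[symmetric] sum_distrib_left ..
    moreover have "(\<Prod>b\<in>Basis. exp (- (\<sigma>\<^sup>2 * (t \<bullet> b)\<^sup>2 / 2))) = exp (- (\<sigma>\<^sup>2 * (t \<bullet> t) / 2))"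
      unfolding zz[of t t] exp_sum[OF finite_Basis, symmetric] sum_negf sum_distrib_left sum_divide_distrib power2_eq_square ..
    ultimately show ?thesis
      unfolding f_def prod.distrib of_real_prod[symmetric] by simp
  qed
  have fi: "integrable lborel (f b)" for b
    unfolding f_def by (rule integrable_gaussian_real[OF s])
  show ?I using integrable_prod_Basis[of f, OF fi] unfolding eq .
  have "(LINT t|lborel. iexp (- (t \<bullet> z)) * complex_of_real (exp (- (\<sigma>\<^sup>2 * (t \<bullet> t) / 2)))) =
    (\<Prod>b\<in>Basis. complex_of_real (sqrt (2 * pi) / \<sigma> * exp (- ((z \<bullet> b)\<^sup>2 / (2 * \<sigma>\<^sup>2)))))"
    using integral_prod_Basis[of f, OF fi] unfolding eq unfolding f_def fourier_gaussian_real[OF s] .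
  also have "\<dots> = complex_of_real ((sqrt (2 * pi) / \<sigma>) ^ DIM('a) * exp (- ((z \<bullet> z) / (2 * \<sigma>\<^sup>2))))"
    unfolding of_real_prod[symmetric] prod.distrib zz[of z z]
    by (simp add: exp_sum[symmetric] sum_negf[symmetric] sum_divide_distrib power2_eq_square)
  finally show ?E .
qed

section \<open>The Plancherel inequality\<close>

definition wave :: "'a::euclidean_space \<Rightarrow> 'a \<Rightarrow> complex" where
  "wave t x = cis (- (t \<bullet> x))"

lemma norm_wave [simp]: "norm (wave t x) = 1"
  by (simp add: wave_def)

lemma wave_0 [simp]: "wave t 0 = 1"
  by (simp add: wave_def)

lemma wave_add: "wave t (x + y) = wave t x * wave t y"
  by (simp add: wave_def cis_mult inner_add_right)

lemma wave_diff: "wave t (x - y) = wave t x * wave t (- y)"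
  by (simp add: wave_def cis_mult inner_diff_right)

lemma cnj_wave: "cnj (wave t x) = wave t (- x)"
  by (simp add: wave_def cis_cnj)

lemma wave_commute: "wave t x = wave x t"
  by (simp add: wave_def inner_commute)

lemma borel_measurable_wave [measurable]:
  assumes [measurable]: "f \<in> borel_measurable M" "g \<in> borel_measurable M"
  shows "(\<lambda>x. wave (f x) (g x)) \<in> borel_measurable M"
proof -
  have "(\<lambda>x. cis (- (f x \<bullet> g x))) \<in> borel_measurable M"
    unfolding cis_conv_exp by measurable
  then show ?thesis by (simp add: wave_def)
qed

definition fourier_const :: "'a::euclidean_space itself \<Rightarrow> real" where
  "fourier_const _ = (2 * pi) powr (- (real DIM('a) / 2))"

lemma fourier_const_pos [simp]: "fourier_const TYPE('a::euclidean_space) > 0"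
  by (simp add: fourier_const_def)

lemma fourier_const_sq: "(fourier_const TYPE('a::euclidean_space))\<^sup>2 * (2 * pi) ^ DIM('a) = 1"
proof -
  have "(2 * pi) ^ DIM('a) = (2 * pi) powr real DIM('a)"
    by (simp add: powr_realpow)
  then show ?thesis
    by (simp only: fourier_const_def power2_eq_square powr_add[symmetric]) simp
qed

lemma fourier_eq: "fourier F t = complex_of_real (fourier_const TYPE('a::euclidean_space)) * (LINT x|lborel. wave t x * F (x::'a))"
  by (simp add: fourier_def fourier_const_def wave_def cis_conv_exp)

lemma integrable_wave_mult:
  assumes "integrable lborel F"
  shows "integrable lborel (\<lambda>x. wave t x * F x)"
  by (rule Bochner_Integration.integrable_bound[OF assms])
     (use assms in \<open>auto simp: norm_mult integrable_iff_bounded\<close>)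

lemma borel_measurable_fourier [measurable]:
  assumes [measurable]: "F \<in> borel_measurable borel"
  shows "fourier F \<in> borel_measurable borel"
  unfolding fourier_eq[abs_def] by measurable

lemma norm_fourier_le:
  "norm (fourier F (t::'a::euclidean_space)) \<le> fourier_const TYPE('a) * (LINT x|lborel. norm (F x))"
proof -
  have "norm (LINT x|lborel. wave t x * F x) \<le> (LINT x|lborel. norm (wave t x * F x))"
    by (rule integral_norm_bound)
  also have "\<dots> = (LINT x|lborel. norm (F x))" by (simp add: norm_mult)
  finally show ?thesis by (simp add: fourier_eq norm_mult less_imp_le)
qed

lemma integral_swap_kernel:
  fixes u v :: "'a::euclidean_space \<Rightarrow> complex"
  assumes u: "integrable lborel u" and v: "integrable lborel v"
    and e[measurable]: "(\<lambda>(t, x). e t x) \<in> borel_measurable (lborel \<Otimes>\<^sub>M lborel)"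
    and e1: "\<And>t x. norm (e t x) \<le> 1"
  shows "(LINT t|lborel. u t * (LINT x|lborel. e t x * v x)) = (LINT x|lborel. v x * (LINT t|lborel. e t x * u t))"
proof -
  have [measurable]: "u \<in> borel_measurable borel" "v \<in> borel_measurable borel"
    using u v by (simp_all add: integrable_iff_bounded)
  have b: "norm (e t x * a) \<le> norm a" for t x a
    using mult_right_mono[OF e1[of t x], of "norm a"] by (simp add: norm_mult)
  have evi: "integrable lborel (\<lambda>x. e t x * v x)" for t
    by (rule Bochner_Integration.integrable_bound[OF v]) (auto intro!: b)
  have "integrable (lborel \<Otimes>\<^sub>M lborel) (\<lambda>(t, x). u t * (e t x * v x))"
  proof (rule lborel_pair.Fubini_integrable)
    show "AE t in lborel. integrable lborel (\<lambda>x. case (t, x) of (t, x) \<Rightarrow> u t * (e t x * v x))"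
      using evi by auto
    show "integrable lborel (\<lambda>t. LINT x|lborel. norm (case (t, x) of (t, x) \<Rightarrow> u t * (e t x * v x)))"
    proof (rule Bochner_Integration.integrable_bound[where f="\<lambda>t. norm (u t) * (LINT x|lborel. norm (v x))"])
      show "integrable lborel (\<lambda>t. norm (u t) * (LINT x|lborel. norm (v x)))"
        using u by auto
      show "AE t in lborel. norm (LINT x|lborel. norm (case (t, x) of (t, x) \<Rightarrow> u t * (e t x * v x)))
          \<le> norm (norm (u t) * (LINT x|lborel. norm (v x)))"
      proof (rule AE_I2)
        fix t
        have "(LINT x|lborel. norm (u t * (e t x * v x))) \<le> (LINT x|lborel. norm (u t) * norm (v x))"
          by (rule integral_mono) (use evi v b in \<open>auto simp: norm_mult[of "u t"] intro!: mult_left_mono\<close>)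
        then show "norm (LINT x|lborel. norm (case (t, x) of (t, x) \<Rightarrow> u t * (e t x * v x)))
          \<le> norm (norm (u t) * (LINT x|lborel. norm (v x)))"
          by simp
      qed
    qed measurable
  qed measurable
  from lborel_pair.Fubini_integral[OF this]
  have "(LINT x|lborel. (LINT t|lborel. u t * (e t x * v x))) = (LINT t|lborel. (LINT x|lborel. u t * (e t x * v x)))"
    by simp
  moreover have "(LINT t|lborel. u t * (e t x * v x)) = v x * (LINT t|lborel. e t x * u t)" for x
    by (subst integral_mult_right_zero[symmetric]) (simp add: mult_ac)
  ultimately show ?thesis by simp
qed

lemma nn_integral_translate:
  fixes f :: "'a::euclidean_space \<Rightarrow> ennreal"
  assumes [measurable]: "f \<in> borel_measurable borel"
  shows "(\<integral>\<^sup>+x. f (x - y) \<partial>lborel) = (\<integral>\<^sup>+x. f x \<partial>lborel)"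
  using nn_integral_affine[of f 1 "- y"] by (simp add: add.commute)

lemma nn_integral_reflect:
  fixes f :: "'a::euclidean_space \<Rightarrow> ennreal"
  assumes [measurable]: "f \<in> borel_measurable borel"
  shows "(\<integral>\<^sup>+x. f (y - x) \<partial>lborel) = (\<integral>\<^sup>+x. f x \<partial>lborel)"
  using nn_integral_affine[of f "-1" y] by simp

text \<open>
  Young's inequality for a positive kernel: \<open>f y f x \<le> ((f x)\<^sup>2 + (f y)\<^sup>2) / 2\<close>, and the kernel has the same mass
  in either variable.
\<close>

lemma sq_double_convolution_le:
  fixes f :: "'a::euclidean_space \<Rightarrow> real" and \<Gamma> :: "'a \<Rightarrow> real"
  assumes [measurable]: "f \<in> borel_measurable borel" "\<Gamma> \<in> borel_measurable borel"
    and f: "\<And>x. f x \<ge> 0" and G: "\<And>x. \<Gamma> x \<ge> 0"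
  shows "(\<integral>\<^sup>+y. (\<integral>\<^sup>+x. ennreal (f y * f x * \<Gamma> (x - y)) \<partial>lborel) \<partial>lborel)
     \<le> (\<integral>\<^sup>+x. ennreal ((f x)\<^sup>2) \<partial>lborel) * (\<integral>\<^sup>+x. ennreal (\<Gamma> x) \<partial>lborel)"
    (is "_ \<le> ?F * ?G")
proof -
  have "ennreal (f y * f x * \<Gamma> (x - y)) \<le>
      ennreal (1/2) * (ennreal ((f x)\<^sup>2) * ennreal (\<Gamma> (x - y))) + ennreal (1/2) * (ennreal ((f y)\<^sup>2) * ennreal (\<Gamma> (x - y)))" for x y
  proof -
    have "f y * f x \<le> 1/2 * (f x)\<^sup>2 + 1/2 * (f y)\<^sup>2"
      using sum_squares_bound[of "f x" "f y"] by (simp add: field_simps)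
    from mult_right_mono[OF this G[of "x - y"]]
    have "f y * f x * \<Gamma> (x - y) \<le> 1/2 * ((f x)\<^sup>2 * \<Gamma> (x - y)) + 1/2 * ((f y)\<^sup>2 * \<Gamma> (x - y))"
      by (simp add: algebra_simps)
    then have "ennreal (f y * f x * \<Gamma> (x - y)) \<le>
        ennreal (1/2 * ((f x)\<^sup>2 * \<Gamma> (x - y)) + 1/2 * ((f y)\<^sup>2 * \<Gamma> (x - y)))"
      by (rule ennreal_leI)
    also have "\<dots> = ennreal (1/2) * (ennreal ((f x)\<^sup>2) * ennreal (\<Gamma> (x - y))) + ennreal (1/2) * (ennreal ((f y)\<^sup>2) * ennreal (\<Gamma> (x - y)))"
    proof -
      have e: "ennreal (1/2 * (a * b)) = ennreal (1/2) * (ennreal a * ennreal b)" if "a \<ge> 0" "b \<ge> 0" for a b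
      proof -
        have "ennreal (1/2 * (a * b)) = ennreal (1/2) * ennreal (a * b)"
          by (rule ennreal_mult) (use that in auto)
        also have "ennreal (a * b) = ennreal a * ennreal b"
          by (rule ennreal_mult) (use that in auto)
        finally show ?thesis .
      qed
      have "0 \<le> 1/2 * ((f x)\<^sup>2 * \<Gamma> (x - y))" "0 \<le> 1/2 * ((f y)\<^sup>2 * \<Gamma> (x - y))"
        using G[of "x - y"] by auto
      then show ?thesis
        unfolding ennreal_plus e[OF zero_le_power2 G] by (simp only: ennreal_plus e[OF zero_le_power2 G])
    qed
    finally show ?thesis .
  qed
  then have "(\<integral>\<^sup>+y. (\<integral>\<^sup>+x. ennreal (f y * f x * \<Gamma> (x - y)) \<partial>lborel) \<partial>lborel) \<le>
     (\<integral>\<^sup>+y. (\<integral>\<^sup>+x. ennreal (1/2) * (ennreal ((f x)\<^sup>2) * ennreal (\<Gamma> (x - y))) +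
       ennreal (1/2) * (ennreal ((f y)\<^sup>2) * ennreal (\<Gamma> (x - y))) \<partial>lborel) \<partial>lborel)"
    by (intro nn_integral_mono)
  also have "\<dots> = ennreal (1/2) * (\<integral>\<^sup>+y. (\<integral>\<^sup>+x. (ennreal ((f x)\<^sup>2) * ennreal (\<Gamma> (x - y))) \<partial>lborel) \<partial>lborel) +
      ennreal (1/2) * (\<integral>\<^sup>+y. (\<integral>\<^sup>+x. (ennreal ((f y)\<^sup>2) * ennreal (\<Gamma> (x - y))) \<partial>lborel) \<partial>lborel)"
    by (simp add: nn_integral_add nn_integral_cmult)
  also have "(\<integral>\<^sup>+y. (\<integral>\<^sup>+x. (ennreal ((f y)\<^sup>2) * ennreal (\<Gamma> (x - y))) \<partial>lborel) \<partial>lborel) = ?F * ?G"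
    by (simp add: nn_integral_cmult nn_integral_multc nn_integral_translate[of "\<lambda>x. ennreal (\<Gamma> x)"])
  also have "(\<integral>\<^sup>+y. (\<integral>\<^sup>+x. (ennreal ((f x)\<^sup>2) * ennreal (\<Gamma> (x - y))) \<partial>lborel) \<partial>lborel) =
     (\<integral>\<^sup>+x. (\<integral>\<^sup>+y. (ennreal ((f x)\<^sup>2) * ennreal (\<Gamma> (x - y))) \<partial>lborel) \<partial>lborel)"
    by (rule lborel_pair.Fubini') measurable
  also have "\<dots> = ?F * ?G"
    by (simp add: nn_integral_cmult nn_integral_multc nn_integral_reflect[of "\<lambda>x. ennreal (\<Gamma> x)"])
  also have "ennreal (1/2) * (?F * ?G) + ennreal (1/2) * (?F * ?G) = ?F * ?G"
  proof -
    have "ennreal (1/2) + ennreal (1/2) = 1"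
      by (subst ennreal_plus[symmetric]) auto
    then show ?thesis unfolding distrib_right[symmetric] by simp
  qed
  finally show ?thesis .
qed


text \<open>
  With a Gaussian weight the integral of \<open>\<bar>fourier f\<bar>\<^sup>2\<close> can be expanded by Fubini's theorem. It becomes a double
  integral of \<open>f\<close> against the transform of the weight, which is a Gaussian of mass \<open>(2\<pi>)\<^sup>n\<close>.
\<close>

lemma gaussian_weighted_plancherel_le:
  fixes f :: "'a::euclidean_space \<Rightarrow> complex"
  assumes f: "integrable lborel f" and s: "\<sigma> > 0"
  shows "(\<integral>\<^sup>+t. ennreal (exp (- (\<sigma>\<^sup>2 * (t \<bullet> t) / 2)) * (norm (fourier f t))\<^sup>2) \<partial>lborel)
     \<le> (\<integral>\<^sup>+x. ennreal ((norm (f x))\<^sup>2) \<partial>lborel)"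
proof -
  have [measurable]: "f \<in> borel_measurable borel"
    using f by (simp add: integrable_iff_bounded)
  define g where "g = (\<lambda>t::'a. exp (- (\<sigma>\<^sup>2 * (t \<bullet> t) / 2)))"
  define U where "U = (\<lambda>t. LINT x|lborel. wave t x * f x)"
  define B where "B = (LINT x|lborel. norm (f x))"
  define \<Gamma> where "\<Gamma> = (\<lambda>z::'a. (sqrt (2 * pi) / \<sigma>) ^ DIM('a) * exp (- ((z \<bullet> z) / (2 * \<sigma>\<^sup>2))))"
  define c where "c = fourier_const TYPE('a)"
  have [measurable]: "g \<in> borel_measurable borel" "U \<in> borel_measurable borel" "\<Gamma> \<in> borel_measurable borel"
    unfolding g_def U_def \<Gamma>_def by measurable
  have UB: "norm (U t) \<le> B" for t
    using integral_norm_bound[of lborel "\<lambda>x. wave t x * f x"] by (simp add: U_def B_def norm_mult)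
  have g0: "g t \<ge> 0" and G0: "\<Gamma> t \<ge> 0" for t
    using s by (simp_all add: g_def \<Gamma>_def)
  have FG: "(LINT t|lborel. wave t z * complex_of_real (g t)) = complex_of_real (\<Gamma> z)"
    and Fi: "integrable lborel (\<lambda>t. wave t z * complex_of_real (g t))" for z
    using fourier_gaussian[OF s, of z] integrable_gaussian[OF s, of z]
    by (simp_all add: wave_def cis_conv_exp g_def \<Gamma>_def)
  have gi: "integrable lborel (\<lambda>t. complex_of_real (g t))"
    using Fi[of 0] by simp
  have Gint: "(\<integral>\<^sup>+z. ennreal (\<Gamma> z) \<partial>lborel) = ennreal ((2 * pi) ^ DIM('a))"
  proof -
    have s': "1 / \<sigma> > 0" using s by simp
    have i: "integrable lborel (\<lambda>z::'a. exp (- ((z \<bullet> z) / (2 * \<sigma>\<^sup>2))))"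
      using integrable_gaussian[OF s', of "0::'a"]
      by (simp add: power_divide mult.commute complex_of_real_integrable_eq)
    have "complex_of_real (LINT z|lborel. exp (- (((z::'a) \<bullet> z) / (2 * \<sigma>\<^sup>2)))) = complex_of_real ((sqrt (2 * pi) * \<sigma>) ^ DIM('a))"
      using fourier_gaussian[OF s', of "0::'a"]
      by (simp add: power_divide mult.commute flip: integral_complex_of_real)
    then have "(LINT z|lborel. exp (- (((z::'a) \<bullet> z) / (2 * \<sigma>\<^sup>2)))) = (sqrt (2 * pi) * \<sigma>) ^ DIM('a)"
      unfolding of_real_eq_iff .
    then have "(LINT z|lborel. \<Gamma> z) = (sqrt (2 * pi) / \<sigma>) ^ DIM('a) * (sqrt (2 * pi) * \<sigma>) ^ DIM('a)"
      unfolding \<Gamma>_def by (subst integral_mult_right_zero) (rule arg_cong)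
    also have "\<dots> = ((sqrt (2 * pi) / \<sigma>) * (sqrt (2 * pi) * \<sigma>)) ^ DIM('a)"
      by (rule power_mult_distrib[symmetric])
    also have "(sqrt (2 * pi) / \<sigma>) * (sqrt (2 * pi) * \<sigma>) = 2 * pi"
      using s by (simp add: field_simps)
    finally have "(LINT z|lborel. \<Gamma> z) = (2 * pi) ^ DIM('a)" .
    moreover have "integrable lborel \<Gamma>"
      unfolding \<Gamma>_def by (intro integrable_mult_right i)
    ultimately show ?thesis
      using G0 by (subst nn_integral_eq_integral) auto
  qed
  have cU: "cnj (U t) = (LINT y|lborel. wave t (- y) * cnj (f y))" for t
  proof -
    have "(LINT y|lborel. wave t (- y) * cnj (f y)) = (LINT y|lborel. cnj (wave t y * f y))"
      by (simp only: complex_cnj_mult cnj_wave)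
    also have "\<dots> = cnj (U t)" unfolding U_def by (simp only: Bochner_Integration.integral_cnj)
    finally show ?thesis ..
  qed
  have b1: "g t * norm (U t) \<le> \<bar>B * g t\<bar>" and b2: "g t * (norm (U t))\<^sup>2 \<le> \<bar>B\<^sup>2 * g t\<bar>" for t
    using mult_left_mono[OF UB g0, of t t] mult_left_mono[OF power_mono[OF UB norm_ge_zero] g0, of t t 2]
    by (auto simp: mult.commute)
  have gr: "integrable lborel g"
    using gi by (simp add: complex_of_real_integrable_eq)
  have gU: "integrable lborel (\<lambda>t. complex_of_real (g t) * U t)"
    by (rule Bochner_Integration.integrable_bound[OF integrable_mult_right[OF gr, of B]])
       (use g0 b1 in \<open>auto simp: norm_mult\<close>)
  have inner: "(LINT t|lborel. wave t (- y) * (complex_of_real (g t) * U t)) =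
      (LINT x|lborel. f x * complex_of_real (\<Gamma> (x - y)))" for y
  proof -
    have "(LINT t|lborel. wave t (- y) * (complex_of_real (g t) * U t)) =
      (LINT t|lborel. (wave t (- y) * complex_of_real (g t)) * (LINT x|lborel. wave t x * f x))"
      by (simp add: U_def mult_ac)
    also have "\<dots> = (LINT x|lborel. f x * (LINT t|lborel. wave t x * (wave t (- y) * complex_of_real (g t))))"
      by (rule integral_swap_kernel) (use Fi f in auto)
    also have "\<dots> = (LINT x|lborel. f x * complex_of_real (\<Gamma> (x - y)))"
      by (simp add: FG[symmetric] wave_diff mult_ac)
    finally show ?thesis .
  qed
  have gU2: "integrable lborel (\<lambda>t. g t * (norm (U t))\<^sup>2)"
    by (rule Bochner_Integration.integrable_bound[OF integrable_mult_right[OF gr, of "B\<^sup>2"]])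
       (use g0 b2 in \<open>auto simp: abs_mult\<close>)
  have "complex_of_real (LINT t|lborel. g t * (norm (U t))\<^sup>2) =
      (LINT t|lborel. (complex_of_real (g t) * U t) * cnj (U t))"
    unfolding integral_complex_of_real[symmetric]
    by (simp only: mult.assoc complex_norm_square[symmetric]) simp
  also have "\<dots> = (LINT t|lborel. (complex_of_real (g t) * U t) * (LINT y|lborel. wave t (- y) * cnj (f y)))"
    by (simp only: cU)
  also have "\<dots> = (LINT y|lborel. cnj (f y) * (LINT t|lborel. wave t (- y) * (complex_of_real (g t) * U t)))"
    by (rule integral_swap_kernel) (use gU f in auto)
  also have "\<dots> = (LINT y|lborel. cnj (f y) * (LINT x|lborel. f x * complex_of_real (\<Gamma> (x - y))))"
    by (simp only: inner)
  finally have eq: "complex_of_real (LINT t|lborel. g t * (norm (U t))\<^sup>2) =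
     (LINT y|lborel. cnj (f y) * (LINT x|lborel. f x * complex_of_real (\<Gamma> (x - y))))" .
  have le_nn: "ennreal (norm (integral\<^sup>L lborel h)) \<le> (\<integral>\<^sup>+x. ennreal (norm (h x)) \<partial>lborel)" for h :: "'a \<Rightarrow> complex"
    by (cases "integrable lborel h") (auto intro: integral_norm_bound_ennreal simp: not_integrable_integral_eq)
  have "ennreal (LINT t|lborel. g t * (norm (U t))\<^sup>2) = ennreal (norm (complex_of_real (LINT t|lborel. g t * (norm (U t))\<^sup>2)))"
    using g0 by (simp add: integral_nonneg_AE)
  also have "\<dots> \<le> (\<integral>\<^sup>+y. ennreal (norm (cnj (f y) * (LINT x|lborel. f x * complex_of_real (\<Gamma> (x - y))))) \<partial>lborel)"
    unfolding eq by (rule le_nn)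
  also have "\<dots> \<le> (\<integral>\<^sup>+y. (\<integral>\<^sup>+x. ennreal (norm (f y) * norm (f x) * \<Gamma> (x - y)) \<partial>lborel) \<partial>lborel)"
  proof (rule nn_integral_mono)
    fix y
    have "ennreal (norm (cnj (f y) * (LINT x|lborel. f x * complex_of_real (\<Gamma> (x - y))))) =
       ennreal (norm (f y)) * ennreal (norm (LINT x|lborel. f x * complex_of_real (\<Gamma> (x - y))))"
      by (simp add: norm_mult ennreal_mult)
    also have "\<dots> \<le> ennreal (norm (f y)) * (\<integral>\<^sup>+x. ennreal (norm (f x * complex_of_real (\<Gamma> (x - y)))) \<partial>lborel)"
      by (intro mult_left_mono le_nn) auto
    also have "\<dots> = (\<integral>\<^sup>+x. ennreal (norm (f y)) * ennreal (norm (f x * complex_of_real (\<Gamma> (x - y)))) \<partial>lborel)"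
      by (rule nn_integral_cmult[symmetric]) measurable
    also have "\<dots> = (\<integral>\<^sup>+x. ennreal (norm (f y) * norm (f x) * \<Gamma> (x - y)) \<partial>lborel)"
      using G0 by (simp add: norm_mult ennreal_mult[symmetric] mult.assoc)
    finally show "ennreal (norm (cnj (f y) * (LINT x|lborel. f x * complex_of_real (\<Gamma> (x - y))))) \<le>
       (\<integral>\<^sup>+x. ennreal (norm (f y) * norm (f x) * \<Gamma> (x - y)) \<partial>lborel)" .
  qed
  also have "\<dots> \<le> (\<integral>\<^sup>+x. ennreal ((norm (f x))\<^sup>2) \<partial>lborel) * ennreal ((2 * pi) ^ DIM('a))"
    using sq_double_convolution_le[of "\<lambda>x. norm (f x)" \<Gamma>] G0 unfolding Gint by simp
  finally have main: "ennreal (LINT t|lborel. g t * (norm (U t))\<^sup>2) \<le> (\<integral>\<^sup>+x. ennreal ((norm (f x))\<^sup>2) \<partial>lborel) * ennreal ((2 * pi) ^ DIM('a))" .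
  have "(\<integral>\<^sup>+t. ennreal (g t * (norm (fourier f t))\<^sup>2) \<partial>lborel) = (\<integral>\<^sup>+t. ennreal (c\<^sup>2) * ennreal (g t * (norm (U t))\<^sup>2) \<partial>lborel)"
    by (intro nn_integral_cong)
       (use g0 in \<open>simp add: fourier_eq U_def c_def norm_mult power_mult_distrib ennreal_mult[symmetric] mult_ac\<close>)
  also have "\<dots> = ennreal (c\<^sup>2) * ennreal (LINT t|lborel. g t * (norm (U t))\<^sup>2)"
    by (subst nn_integral_cmult) (use gU2 g0 in \<open>auto simp: nn_integral_eq_integral\<close>)
  also have "\<dots> \<le> ennreal (c\<^sup>2) * ((\<integral>\<^sup>+x. ennreal ((norm (f x))\<^sup>2) \<partial>lborel) * ennreal ((2 * pi) ^ DIM('a)))"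
    by (intro mult_left_mono main) auto
  also have "\<dots> = ennreal (c\<^sup>2 * (2 * pi) ^ DIM('a)) * (\<integral>\<^sup>+x. ennreal ((norm (f x))\<^sup>2) \<partial>lborel)"
    by (subst ennreal_mult) (auto simp: mult_ac)
  also have "\<dots> = (\<integral>\<^sup>+x. ennreal ((norm (f x))\<^sup>2) \<partial>lborel)"
    unfolding c_def fourier_const_sq by simp
  finally show ?thesis by (simp add: g_def)
qed

text \<open>
  The weights increase to one as \<open>\<sigma>\<close> tends to zero; Fatou's lemma gives the inequality in the limit.
\<close>

lemma plancherel_le:
  fixes f :: "'a::euclidean_space \<Rightarrow> complex"
  assumes f: "integrable lborel f"
  shows "(\<integral>\<^sup>+t. ennreal ((norm (fourier f t))\<^sup>2) \<partial>lborel) \<le> (\<integral>\<^sup>+x. ennreal ((norm (f x))\<^sup>2) \<partial>lborel)"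
    (is "_ \<le> ?R")
proof -
  have [measurable]: "f \<in> borel_measurable borel"
    using f by (simp add: integrable_iff_bounded)
  let ?h = "\<lambda>j t. ennreal (exp (- ((1 / real (Suc j))\<^sup>2 * (t \<bullet> t) / 2)) * (norm (fourier f t))\<^sup>2)"
  have lim: "(\<lambda>j. ?h j t) \<longlonglongrightarrow> ennreal ((norm (fourier f t))\<^sup>2)" for t
  proof -
    have "(\<lambda>j. exp (- ((1 / real (Suc j))\<^sup>2 * (t \<bullet> t) / 2)) * (norm (fourier f t))\<^sup>2)
        \<longlonglongrightarrow> exp (- (0\<^sup>2 * (t \<bullet> t) / 2)) * (norm (fourier f t))\<^sup>2"
      by (intro tendsto_intros LIMSEQ_Suc lim_1_over_n) auto
    then show ?thesis by (intro tendsto_ennrealI) simp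
  qed
  have "(\<integral>\<^sup>+t. ennreal ((norm (fourier f t))\<^sup>2) \<partial>lborel) = (\<integral>\<^sup>+t. liminf (\<lambda>j. ?h j t) \<partial>lborel)"
    by (rule nn_integral_cong, rule lim_imp_Liminf[OF _ lim, symmetric]) simp
  also have "\<dots> \<le> liminf (\<lambda>j. \<integral>\<^sup>+t. ?h j t \<partial>lborel)"
    by (rule nn_integral_liminf) measurable
  also have "\<dots> \<le> liminf (\<lambda>j::nat. ?R)"
    by (intro Liminf_mono always_eventually allI gaussian_weighted_plancherel_le[OF f]) auto
  also have "\<dots> = ?R" by (simp add: Liminf_const)
  finally show ?thesis .
qed

section \<open>Energy and the Fourier--Plancherel transform\<close>

definition energy :: "('a::euclidean_space \<Rightarrow> complex) \<Rightarrow> real" where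
  "energy f = (LINT x|lborel. (norm (f x))\<^sup>2)"

lemma energy_nonneg [simp]: "energy f \<ge> 0"
  by (simp add: energy_def)

lemma sq_integrable_measurable [measurable_dest]: "sq_integrable f \<Longrightarrow> f \<in> borel_measurable borel"
  by (simp add: sq_integrable_def)

lemma nn_integral_energy:
  "sq_integrable f \<Longrightarrow> (\<integral>\<^sup>+x. ennreal ((norm (f x))\<^sup>2) \<partial>lborel) = ennreal (energy f)"
  unfolding energy_def sq_integrable_def by (intro nn_integral_eq_integral) auto

lemma sq_integrableI:
  assumes "f \<in> borel_measurable borel" and "(\<integral>\<^sup>+x. ennreal ((norm (f x))\<^sup>2) \<partial>lborel) \<le> ennreal c"
  shows "sq_integrable f"
  unfolding sq_integrable_def using assms
  by (auto intro!: integrableI_bounded le_less_trans[OF assms(2)])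

lemma energy_leI:
  assumes "(\<integral>\<^sup>+x. ennreal ((norm (f x))\<^sup>2) \<partial>lborel) \<le> ennreal c" "c \<ge> 0" "f \<in> borel_measurable borel"
  shows "energy f \<le> c"
  using assms nn_integral_energy[OF sq_integrableI[OF assms(3,1)]] by simp

lemma sq_integrable_le:
  assumes [measurable]: "f \<in> borel_measurable borel" and g: "sq_integrable g"
    and "\<And>x. norm (f x) \<le> norm (g x)"
  shows "sq_integrable f"
  unfolding sq_integrable_def
  by (auto intro!: Bochner_Integration.integrable_bound[OF g[unfolded sq_integrable_def, THEN conjunct2]] power_mono assms(3))

lemma sq_integrable_cmult:
  assumes "sq_integrable f" shows "sq_integrable (\<lambda>x. c * f x)"
  using assms unfolding sq_integrable_def by (auto simp: norm_mult power_mult_distrib)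

lemma sq_integrable_add:
  assumes f: "sq_integrable f" and g: "sq_integrable g" shows "sq_integrable (\<lambda>x. f x + g x)"
proof -
  have [measurable]: "f \<in> borel_measurable borel" "g \<in> borel_measurable borel" using f g by auto
  have "integrable lborel (\<lambda>x. 2 * (norm (f x))\<^sup>2 + 2 * (norm (g x))\<^sup>2)"
    using f g by (auto simp: sq_integrable_def)
  moreover have "(norm (f x + g x))\<^sup>2 \<le> 2 * (norm (f x))\<^sup>2 + 2 * (norm (g x))\<^sup>2" for x
  proof -
    have "(norm (f x + g x))\<^sup>2 \<le> (norm (f x) + norm (g x))\<^sup>2"
      by (intro power_mono norm_triangle_ineq) auto
    also have "\<dots> \<le> 2 * (norm (f x))\<^sup>2 + 2 * (norm (g x))\<^sup>2"
      using sum_squares_bound[of "norm (f x)" "norm (g x)"] by (simp add: power2_sum)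
    finally show ?thesis .
  qed
  ultimately show ?thesis
    unfolding sq_integrable_def by (auto intro: Bochner_Integration.integrable_bound)
qed

lemma sq_integrable_indicator:
  assumes "sq_integrable f" "A \<in> sets borel" shows "sq_integrable (\<lambda>x. indicator A x * f x)"
  by (rule sq_integrable_le[OF _ assms(1)]) (use assms in \<open>auto simp: indicator_def norm_mult\<close>)

lemma sq_integrable_inner:
  assumes f: "sq_integrable f" and g: "sq_integrable g"
  shows "integrable lborel (\<lambda>x. Re (f x * cnj (g x)))"
proof (rule Bochner_Integration.integrable_bound)
  show "integrable lborel (\<lambda>x. (norm (f x))\<^sup>2 + (norm (g x))\<^sup>2)"
    using f g by (auto simp: sq_integrable_def)
  have [measurable]: "f \<in> borel_measurable borel" "g \<in> borel_measurable borel" using f g by auto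
  show "(\<lambda>x. Re (f x * cnj (g x))) \<in> borel_measurable lborel" by simp measurable
  have "\<bar>Re (f x * cnj (g x))\<bar> \<le> (norm (f x))\<^sup>2 + (norm (g x))\<^sup>2" for x
  proof -
    have "\<bar>Re (f x * cnj (g x))\<bar> \<le> norm (f x) * norm (g x)"
      using abs_Re_le_cmod[of "f x * cnj (g x)"] by (simp add: norm_mult)
    moreover have "0 \<le> norm (f x) * norm (g x)" by simp
    ultimately show ?thesis
      using sum_squares_bound[of "norm (f x)" "norm (g x)"] by (simp add: mult.assoc)
  qed
  then show "AE x in lborel. norm (Re (f x * cnj (g x))) \<le> norm ((norm (f x))\<^sup>2 + (norm (g x))\<^sup>2)"
    by (intro AE_I2) (metis abs_ge_self order_trans real_norm_def)
qed

lemma cmod_lincomb_sq: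
  "(norm (complex_of_real a * z + complex_of_real b * w))\<^sup>2 = a\<^sup>2 * (norm z)\<^sup>2 + 2 * a * b * Re (z * cnj w) + b\<^sup>2 * (norm w)\<^sup>2"
  unfolding cmod_power2 by (simp add: power2_eq_square algebra_simps)

lemma energy_lincomb:
  assumes f: "sq_integrable f" and g: "sq_integrable g"
  shows "energy (\<lambda>x. complex_of_real a * f x + complex_of_real b * g x) =
     a\<^sup>2 * energy f + 2 * a * b * (LINT x|lborel. Re (f x * cnj (g x))) + b\<^sup>2 * energy g"
  using f g sq_integrable_inner[OF f g]
  unfolding energy_def cmod_lincomb_sq sq_integrable_def by simp

text \<open>
  On a bounded set \<open>\<bar>f\<bar> \<le> 1 + \<bar>f\<bar>\<^sup>2\<close> is integrable.
\<close>

lemma sq_integrable_imp_integrable: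
  assumes f: "sq_integrable f" and A: "bounded A" and z: "\<And>x. x \<notin> A \<Longrightarrow> f x = 0"
  shows "integrable lborel f"
proof -
  obtain R where R: "A \<subseteq> cball 0 R"
    using A unfolding bounded_iff by (auto simp: subset_eq)
  have "integrable lborel (\<lambda>x. indicator (cball 0 R) x + (norm (f x))\<^sup>2)"
    using f by (auto simp: sq_integrable_def intro!: integrable_real_indicator emeasure_lborel_cball_finite)
  moreover have "f \<in> borel_measurable lborel" using f by auto
  moreover have "norm (f x) \<le> indicator (cball 0 R) x + (norm (f x))\<^sup>2" for x
  proof (cases "x \<in> A")
    case True
    moreover have "norm (f x) \<le> 1 + (norm (f x))\<^sup>2"
      using sum_squares_bound[of 1 "norm (f x)", unfolded mult_1_right one_power2] norm_ge_zero[of "f x"] by linarith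
    ultimately show ?thesis using R by (auto simp: indicator_def)
  qed (simp add: z)
  then have "AE x in lborel. norm (f x) \<le> norm (indicator (cball 0 R) x + (norm (f x))\<^sup>2)"
    by (intro AE_I2) (metis abs_ge_self order_trans real_norm_def)
  ultimately show ?thesis by (rule Bochner_Integration.integrable_bound)
qed

lemma
  assumes "integrable lborel f" "sq_integrable f"
  shows sq_integrable_fourier: "sq_integrable (fourier f)"
    and energy_fourier_le: "energy (fourier f) \<le> energy f"
proof -
  have "(\<integral>\<^sup>+t. ennreal ((norm (fourier f t))\<^sup>2) \<partial>lborel) \<le> ennreal (energy f)"
    using plancherel_le[OF assms(1)] nn_integral_energy[OF assms(2)] by simp
  moreover have "fourier f \<in> borel_measurable borel" using assms(2) by measurable
  ultimately show "sq_integrable (fourier f)" "energy (fourier f) \<le> energy f"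
    by (auto intro: sq_integrableI energy_leI)
qed

lemma fourier_lincomb:
  assumes "integrable lborel f" "integrable lborel g"
  shows "fourier (\<lambda>x. a * f x + b * g x) t = a * fourier f t + b * fourier g t"
  using integrable_wave_mult[OF assms(1), of t] integrable_wave_mult[OF assms(2), of t]
  by (simp add: fourier_eq algebra_simps mult.left_commute[of "wave _ _"])

text \<open>
  A substitute for Minkowski's inequality: the second term may carry a large constant because it will tend to zero.
\<close>

lemma norm_add_sq_le:
  fixes z w :: complex
  assumes "\<delta> > 0"
  shows "(norm (z + w))\<^sup>2 \<le> (1 + \<delta>) * (norm z)\<^sup>2 + (1 + 1 / \<delta>) * (norm w)\<^sup>2"
proof -
  have "(norm (z + w))\<^sup>2 \<le> (norm z + norm w)\<^sup>2"
    by (intro power_mono norm_triangle_ineq) auto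
  also have "\<dots> \<le> (1 + \<delta>) * (norm z)\<^sup>2 + (1 + 1 / \<delta>) * (norm w)\<^sup>2"
  proof -
    have "0 \<le> (\<delta> * norm z - norm w)\<^sup>2 / \<delta>" using assms by simp
    also have "\<dots> = \<delta> * (norm z)\<^sup>2 - 2 * (norm z * norm w) + (norm w)\<^sup>2 / \<delta>"
      using assms by (simp add: power2_diff field_simps power2_eq_square)
    finally show ?thesis by (simp add: power2_sum algebra_simps)
  qed
  finally show ?thesis .
qed

text \<open>
  The Plancherel inequality for a combination of \<open>F\<close> and its truncation \<open>k\<close>. It holds for the truncations of \<open>F\<close> to
  large balls that contain \<open>K\<close>, and their transforms converge to \<open>G\<close>.
\<close>

lemma L2_fourier_lincomb_le:
  fixes F G :: "'a::euclidean_space \<Rightarrow> complex"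
  assumes FG: "has_L2_fourier F G" and K: "bounded K" "K \<in> sets borel"
  defines "k \<equiv> \<lambda>x. indicator K x * F x"
  shows "energy (\<lambda>t. complex_of_real a * fourier k t + complex_of_real b * G t)
     \<le> energy (\<lambda>x. complex_of_real a * k x + complex_of_real b * F x)"
proof -
  let ?a = "complex_of_real a" and ?b = "complex_of_real b"
  define FR where "FR = (\<lambda>R x. indicator (cball 0 R) x * F x)"
  define E where "E = (\<lambda>R. \<integral>\<^sup>+t. ennreal ((norm (fourier (FR R) t - G t))\<^sup>2) \<partial>lborel)"
  define N where "N = energy (\<lambda>x. ?a * k x + ?b * F x)"
  define X where "X = (\<integral>\<^sup>+t. ennreal ((norm (?a * fourier k t + ?b * G t))\<^sup>2) \<partial>lborel)"
  have F: "sq_integrable F" and G: "sq_integrable G" and E0: "(E \<longlongrightarrow> 0) at_top"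
    using FG by (auto simp: has_L2_fourier_def E_def FR_def)
  have sqk: "sq_integrable k" unfolding k_def by (rule sq_integrable_indicator[OF F K(2)])
  have ik: "integrable lborel k"
    by (rule sq_integrable_imp_integrable[OF sqk K(1)]) (simp add: k_def)
  have sqR: "sq_integrable (FR R)" for R unfolding FR_def by (rule sq_integrable_indicator[OF F]) simp
  have iR: "integrable lborel (FR R)" for R
    by (rule sq_integrable_imp_integrable[OF sqR bounded_cball[of 0 R]]) (simp add: FR_def)
  have [measurable]: "F \<in> borel_measurable borel" "G \<in> borel_measurable borel" "k \<in> borel_measurable borel" "FR R \<in> borel_measurable borel" for R
    using F G sqk sqR by auto
  have sqN: "sq_integrable (\<lambda>x. ?a * k x + ?b * F x)"
    by (intro sq_integrable_add sq_integrable_cmult sqk F)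
  obtain R0 where R0: "K \<subseteq> cball 0 R0"
    using K(1) unfolding bounded_iff by (auto simp: subset_eq)
  have le: "X \<le> ennreal (1 + \<delta>) * ennreal N + ennreal ((1 + 1 / \<delta>) * b\<^sup>2) * E R"
    if d: "\<delta> > 0" and R: "R \<ge> R0" for \<delta> R
  proof -
    have "(norm (?a * fourier k t + ?b * G t))\<^sup>2 \<le> (1 + \<delta>) * (norm (fourier (\<lambda>x. ?a * k x + ?b * FR R x) t))\<^sup>2
        + ((1 + 1 / \<delta>) * b\<^sup>2) * (norm (fourier (FR R) t - G t))\<^sup>2" for t
    proof -
      have "?a * fourier k t + ?b * G t = fourier (\<lambda>x. ?a * k x + ?b * FR R x) t + ?b * (G t - fourier (FR R) t)"
        unfolding fourier_lincomb[OF ik iR] by (simp add: algebra_simps)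
      then show ?thesis
        using norm_add_sq_le[OF d, of "fourier (\<lambda>x. ?a * k x + ?b * FR R x) t" "?b * (G t - fourier (FR R) t)"]
        by (simp add: norm_mult power_mult_distrib norm_minus_commute mult.assoc)
    qed
    then have "X \<le> (\<integral>\<^sup>+t. ennreal (1 + \<delta>) * ennreal ((norm (fourier (\<lambda>x. ?a * k x + ?b * FR R x) t))\<^sup>2)
        + ennreal ((1 + 1 / \<delta>) * b\<^sup>2) * ennreal ((norm (fourier (FR R) t - G t))\<^sup>2) \<partial>lborel)"
      unfolding X_def using d
      by (intro nn_integral_mono) (simp add: ennreal_mult[symmetric] ennreal_plus[symmetric] ennreal_leI del: ennreal_plus)
    also have "\<dots> = ennreal (1 + \<delta>) * (\<integral>\<^sup>+t. ennreal ((norm (fourier (\<lambda>x. ?a * k x + ?b * FR R x) t))\<^sup>2) \<partial>lborel)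
        + ennreal ((1 + 1 / \<delta>) * b\<^sup>2) * E R"
      unfolding E_def by (simp add: nn_integral_add nn_integral_cmult)
    also have "(\<integral>\<^sup>+t. ennreal ((norm (fourier (\<lambda>x. ?a * k x + ?b * FR R x) t))\<^sup>2) \<partial>lborel) \<le>
        (\<integral>\<^sup>+x. ennreal ((norm (?a * k x + ?b * FR R x))\<^sup>2) \<partial>lborel)"
      by (rule plancherel_le) (intro Bochner_Integration.integrable_add integrable_mult_right ik iR)
    also have "\<dots> \<le> (\<integral>\<^sup>+x. ennreal ((norm (?a * k x + ?b * F x))\<^sup>2) \<partial>lborel)"
    proof (intro nn_integral_mono ennreal_leI power_mono)
      fix x
      show "norm (?a * k x + ?b * FR R x) \<le> norm (?a * k x + ?b * F x)"
      proof (cases "x \<in> cball 0 R")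
        case False
        then have "x \<notin> K" using R0 R by auto
        then show ?thesis using False by (simp add: k_def FR_def)
      qed (simp add: FR_def)
    qed auto
    also have "\<dots> = ennreal N" unfolding N_def by (rule nn_integral_energy[OF sqN])
    finally show ?thesis by (simp add: mult_left_mono add_right_mono)
  qed
  have le2: "X \<le> ennreal ((1 + \<delta>) * N)" if d: "\<delta> > 0" for \<delta>
  proof (rule tendsto_lowerbound)
    show "((\<lambda>R. ennreal (1 + \<delta>) * ennreal N + ennreal ((1 + 1 / \<delta>) * b\<^sup>2) * E R) \<longlongrightarrow> ennreal ((1 + \<delta>) * N)) at_top"
    proof -
      have "((\<lambda>R. ennreal (1 + \<delta>) * ennreal N + ennreal ((1 + 1 / \<delta>) * b\<^sup>2) * E R) \<longlongrightarrow>
          ennreal (1 + \<delta>) * ennreal N + ennreal ((1 + 1 / \<delta>) * b\<^sup>2) * 0) at_top"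
        by (intro tendsto_add tendsto_const ennreal_tendsto_cmult E0) auto
      then show ?thesis using d by (simp add: ennreal_mult N_def)
    qed
    show "\<forall>\<^sub>F R in at_top. X \<le> ennreal (1 + \<delta>) * ennreal N + ennreal ((1 + 1 / \<delta>) * b\<^sup>2) * E R"
      using eventually_ge_at_top[of R0] by eventually_elim (rule le[OF d])
  qed simp
  have "X \<le> ennreal N"
  proof (rule tendsto_lowerbound)
    have "((\<lambda>n. (1 + 1 / real (Suc n)) * N) \<longlonglongrightarrow> (1 + 0) * N)"
      by (intro tendsto_intros LIMSEQ_Suc lim_1_over_n)
    then show "(\<lambda>n. ennreal ((1 + 1 / real (Suc n)) * N)) \<longlonglongrightarrow> ennreal N"
      by (intro tendsto_ennrealI) simp
    show "\<forall>\<^sub>F n in sequentially. X \<le> ennreal ((1 + 1 / real (Suc n)) * N)"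
      by (intro always_eventually allI le2) simp
  qed simp
  then show ?thesis
    unfolding X_def N_def[symmetric] by (rule energy_leI) (auto simp: N_def)
qed

section \<open>Concentration as an angle between subspaces\<close>

text \<open>
  Here \<open>q\<close> is the squared cosine of the angle between \<open>F\<close> and \<open>k\<close>, \<open>g\<close> that of the angle between \<open>G\<close> and its
  restriction to \<open>S\<close>, and \<open>A\<close>, \<open>B\<close> are the energy of \<open>fourier k\<close> in \<open>S\<close> and its inner product there with
  \<open>G\<close>. The two hypotheses are the positivity of a Gram matrix and the Plancherel inequality for all real combinations
  of \<open>k\<close> and \<open>F\<close>. They give the triangle inequality for angles; both angles have cosine above
  \<open>7/8\<close>, so their sum has cosine above \<open>2 (7/8)\<^sup>2 - 1 = 17/32\<close>.
\<close>

lemma angle_algebra: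
  fixes A B g q :: real
  assumes pos: "\<And>a b. 0 \<le> a\<^sup>2 * A + 2 * a * b * B + b\<^sup>2 * g"
    and le: "\<And>a b. a\<^sup>2 * A + 2 * a * b * B + b\<^sup>2 * g \<le> (a\<^sup>2 + 2 * a * b) * q + b\<^sup>2"
    and q: "q > (7/8)\<^sup>2" "q \<le> 1" and g: "g > (7/8)\<^sup>2"
  shows "(17/32)\<^sup>2 * q \<le> A"
proof (rule ccontr)
  assume "\<not> ?thesis"
  then have Aq: "A < (17/32)\<^sup>2 * q" by simp
  have A0: "A \<ge> 0" using pos[of 1 0] by simp
  have g1: "g \<le> 1" using le[of 0 1] by simp
  have qA: "q - A > 0" using Aq q(1) by (simp add: power2_eq_square)
  have "0 \<le> g * (A * g - B\<^sup>2)"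
    using pos[of g "- B"] by (simp add: algebra_simps power2_eq_square)
  then have BA: "B\<^sup>2 \<le> A * g"
    using g by (simp add: zero_le_mult_iff power2_eq_square)
  have "0 \<le> (q - A) * ((q - A) * (1 - g) - (q - B)\<^sup>2)"
    using le[of "- (q - B)" "q - A"] by (simp add: algebra_simps power2_eq_square)
  then have Bq: "(q - B)\<^sup>2 \<le> (q - A) * (1 - g)"
    using qA by (simp add: zero_le_mult_iff)
  define \<kappa> where "\<kappa> = sqrt q"
  define \<gamma> where "\<gamma> = sqrt g"
  \<comment> \<open>The cosine of the angle between \<open>k\<close> and \<open>S\<close>; the two discriminants bound it below by
    \<open>\<kappa> \<gamma> - sqrt ((1 - \<kappa>\<^sup>2) (1 - \<gamma>\<^sup>2))\<close>, the cosine of the sum of the angles.\<close>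
  define x where "x = sqrt A / \<kappa>"
  have k: "\<kappa> > 7/8" "\<kappa> \<le> 1" "\<kappa>\<^sup>2 = q"
    using q real_less_rsqrt[of "7/8" q] by (auto simp: \<kappa>_def power2_eq_square)
  have c: "\<gamma> > 7/8" "\<gamma> \<le> 1" "\<gamma>\<^sup>2 = g"
    using g g1 real_less_rsqrt[of "7/8" g] by (auto simp: \<gamma>_def power2_eq_square)
  have Ax: "A = \<kappa>\<^sup>2 * x\<^sup>2" and x0: "x \<ge> 0"
    using k A0 by (auto simp: x_def power_divide)
  have x1: "x < 17/32"
  proof (rule power_less_imp_less_base)
    show "x\<^sup>2 < (17/32)\<^sup>2" using Aq k(1) unfolding Ax k(3)[symmetric]
      by (simp add: mult.commute)
  qed simp
  have Bx: "B \<le> \<kappa> * x * \<gamma>"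
  proof (rule power2_le_imp_le)
    show "B\<^sup>2 \<le> (\<kappa> * x * \<gamma>)\<^sup>2" using BA by (simp add: Ax c(3)[symmetric] power_mult_distrib)
    show "0 \<le> \<kappa> * x * \<gamma>" using k(1) x0 c(1) by auto
  qed
  have xg: "x * \<gamma> \<le> x" using x0 c by (intro mult_left_le) auto
  have "0 \<le> \<kappa> * (\<kappa> - x * \<gamma>)" using xg x1 k(1) by (intro mult_nonneg_nonneg) auto
  moreover have "\<kappa> * (\<kappa> - x * \<gamma>) \<le> q - B"
    using Bx by (simp add: k(3)[symmetric] power2_eq_square algebra_simps)
  ultimately have "(\<kappa> * (\<kappa> - x * \<gamma>))\<^sup>2 \<le> (q - B)\<^sup>2"
    by (intro power_mono)
  also have "\<dots> \<le> \<kappa>\<^sup>2 * ((1 - x\<^sup>2) * (1 - \<gamma>\<^sup>2))"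
    using Bq by (simp add: Ax k(3)[symmetric] c(3)[symmetric] algebra_simps)
  finally have "(\<kappa> - x * \<gamma>)\<^sup>2 \<le> (1 - x\<^sup>2) * (1 - \<gamma>\<^sup>2)"
    using k(1) by (simp add: power_mult_distrib)
  then have "(\<kappa> * \<gamma> - x)\<^sup>2 \<le> (1 - \<kappa>\<^sup>2) * (1 - \<gamma>\<^sup>2)"
    by (simp add: algebra_simps power2_eq_square)
  also have "\<dots> \<le> (15/64) * (15/64)"
    using q g g1 unfolding k(3) c(3) by (intro mult_mono) (auto simp: power2_eq_square)
  finally have "\<kappa> * \<gamma> - x \<le> 15/64"
    using power2_le_imp_le[of "\<kappa> * \<gamma> - x" "15/64"] by (simp add: power2_eq_square)
  moreover have "\<kappa> * \<gamma> > 49/64"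
    using mult_strict_mono[OF k(1) c(1)] k(1) by simp
  ultimately show False using x1 by linarith
qed

lemma L2_norm_on_eq: "L2_norm_on A F = sqrt (energy (\<lambda>x. indicator A x * F x))"
  unfolding L2_norm_on_def energy_def set_lebesgue_integral_def
  by (intro arg_cong[where f=sqrt] Bochner_Integration.integral_cong) (auto simp: indicator_def)

lemma energy_indicator_le:
  assumes "sq_integrable f" "A \<in> sets borel"
  shows "energy (\<lambda>x. indicator A x * f x) \<le> energy f"
  unfolding energy_def
  using sq_integrable_indicator[OF assms] assms(1)
  by (intro integral_mono) (auto simp: sq_integrable_def indicator_def)

text \<open>
  The restriction of a concentrated function to \<open>K\<close> still has a definite part of its spectral energy in \<open>S\<close>, and in
  addition it vanishes outside \<open>K\<close>, which makes its disjoint translates orthogonal.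
\<close>

lemma concentrated_truncation:
  fixes S K :: "'a::euclidean_space set"
  assumes "admits_concentration S K" and S: "S \<in> sets borel" and K: "bounded K" "K \<in> sets borel"
  obtains k where "sq_integrable k" "integrable lborel k" "\<And>x. x \<notin> K \<Longrightarrow> k x = 0" "energy k > 0"
    "(17/32)\<^sup>2 * energy k \<le> energy (\<lambda>t. indicator S t * fourier k t)"
proof -
  obtain F G where FG: "has_L2_fourier F G" and F1: "L2_norm_on UNIV F = 1"
    and FK: "L2_norm_on K F > 7/8" and GS: "L2_norm_on S G > 7/8"
    using assms(1) unfolding admits_concentration_def by blast
  have F: "sq_integrable F" and G: "sq_integrable G"
    using FG by (auto simp: has_L2_fourier_def)
  define k where "k = (\<lambda>x. indicator K x * F x)"
  have sqk: "sq_integrable k" unfolding k_def by (rule sq_integrable_indicator[OF F K(2)])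
  have ik: "integrable lborel k"
    by (rule sq_integrable_imp_integrable[OF sqk K(1)]) (simp add: k_def)
  define u where "u = (\<lambda>t. indicator S t * fourier k t)"
  define v where "v = (\<lambda>t. indicator S t * G t)"
  have u: "sq_integrable u" and v: "sq_integrable v"
    unfolding u_def v_def by (intro sq_integrable_indicator sq_integrable_fourier ik sqk G S)+
  have EF: "energy F = 1" using F1 by (simp add: L2_norm_on_eq)
  have Ek: "energy k > (7/8)\<^sup>2"
    using FK unfolding L2_norm_on_eq k_def[symmetric]
    by (metis energy_nonneg real_sqrt_pow2 power_strict_mono zero_less_numeral zero_le_divide_iff zero_le_numeral pos2)
  have Ev: "energy v > (7/8)\<^sup>2"
    using GS unfolding L2_norm_on_eq v_def[symmetric]
    by (metis energy_nonneg real_sqrt_pow2 power_strict_mono zero_less_numeral zero_le_divide_iff zero_le_numeral pos2)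
  have Ek1: "energy k \<le> 1"
    unfolding k_def EF[symmetric] by (rule energy_indicator_le[OF F K(2)])
  have kF: "(LINT x|lborel. Re (k x * cnj (F x))) = energy k"
    unfolding energy_def
  proof (intro Bochner_Integration.integral_cong refl)
    fix x
    have re: "Re (z * cnj z) = (norm z)\<^sup>2" for z
      unfolding cmod_power2 by (simp add: power2_eq_square)
    show "Re (k x * cnj (F x)) = (norm (k x))\<^sup>2"
    proof (cases "x \<in> K")
      case True
      then have "k x = F x" by (simp add: k_def)
      then show ?thesis by (simp only: re)
    qed (simp add: k_def)
  qed
  define B where "B = (LINT x|lborel. Re (u x * cnj (v x)))"
  have "(17/32)\<^sup>2 * energy k \<le> energy u"
  proof (rule angle_algebra)
    fix a b :: real
    let ?h = "\<lambda>x. complex_of_real a * u x + complex_of_real b * v x"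
    have e: "energy ?h = a\<^sup>2 * energy u + 2 * a * b * B + b\<^sup>2 * energy v"
      unfolding B_def by (rule energy_lincomb[OF u v])
    then show "0 \<le> a\<^sup>2 * energy u + 2 * a * b * B + b\<^sup>2 * energy v"
      using energy_nonneg[of ?h] by simp
    have "?h = (\<lambda>t. indicator S t * (complex_of_real a * fourier k t + complex_of_real b * G t))"
      by (auto simp: u_def v_def algebra_simps)
    then have "energy ?h \<le> energy (\<lambda>t. complex_of_real a * fourier k t + complex_of_real b * G t)"
      using energy_indicator_le[OF _ S, of "\<lambda>t. complex_of_real a * fourier k t + complex_of_real b * G t"]
        sq_integrable_add[OF sq_integrable_cmult[OF sq_integrable_fourier[OF ik sqk]] sq_integrable_cmult[OF G]]
      by simp
    also have "\<dots> \<le> energy (\<lambda>x. complex_of_real a * k x + complex_of_real b * F x)"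
      unfolding k_def by (rule L2_fourier_lincomb_le[OF FG K])
    also have "\<dots> = (a\<^sup>2 + 2 * a * b) * energy k + b\<^sup>2"
      unfolding energy_lincomb[OF sqk F] kF EF by (simp add: algebra_simps)
    finally show "a\<^sup>2 * energy u + 2 * a * b * B + b\<^sup>2 * energy v \<le> (a\<^sup>2 + 2 * a * b) * energy k + b\<^sup>2"
      unfolding e .
  qed (use Ek Ek1 Ev in auto)
  moreover have "energy k > 0" using Ek by (rule le_less_trans[rotated]) simp
  ultimately show thesis
    using that[of k] sqk ik by (auto simp: u_def k_def)
qed

section \<open>Translates with disjoint supports\<close>

definition packing :: "'a::real_vector set \<Rightarrow> 'a set \<Rightarrow> bool" where
  "packing K X \<longleftrightarrow> (\<forall>x\<in>X. \<forall>y\<in>X. x \<noteq> y \<longrightarrow> (\<forall>a\<in>K. \<forall>b\<in>K. x + a \<noteq> y + b))"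

lemma packing_subset: "packing K X \<Longrightarrow> Y \<subseteq> X \<Longrightarrow> packing K Y"
  unfolding packing_def by blast

lemma packing_mono: "packing K X \<Longrightarrow> L \<subseteq> K \<Longrightarrow> packing L X"
  unfolding packing_def by blast

lemma integral_translate:
  fixes f :: "'a::euclidean_space \<Rightarrow> 'b::{banach, second_countable_topology}"
  assumes [measurable]: "f \<in> borel_measurable borel"
  shows "(LINT x|lborel. f (x - y)) = (LINT x|lborel. f x)"
  using integral_affine[of f 1 "- y"] by (simp add: add.commute)

lemma integrable_translate:
  fixes f :: "'a::euclidean_space \<Rightarrow> 'b::{banach, second_countable_topology}"
  assumes "integrable lborel f"
  shows "integrable lborel (\<lambda>x. f (x - y))"
  using integrable_affine[of f 1 "- y"] assms by (simp add: add.commute)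

lemma fourier_translate:
  assumes [measurable]: "k \<in> borel_measurable borel"
  shows "fourier (\<lambda>y. k (y - x)) t = wave t x * fourier k t"
proof -
  have "(LINT y|lborel. wave t y * k (y - x)) = (LINT y|lborel. wave t x * (wave t (y - x) * k (y - x)))"
    by (simp add: mult.assoc[symmetric] wave_add[symmetric])
  also have "\<dots> = wave t x * (LINT y|lborel. wave t y * k y)"
    by (subst integral_mult_right_zero, subst integral_translate[of "\<lambda>y. wave t y * k y"]) auto
  finally show ?thesis by (simp add: fourier_eq)
qed

lemma fourier_sum_translates:
  fixes X :: "'a::euclidean_space set"
  assumes k: "integrable lborel k"
  shows "fourier (\<lambda>y. \<Sum>x\<in>X. c x * k (y - x)) t = (\<Sum>x\<in>X. c x * wave t x) * fourier k t"
proof -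
  have [measurable]: "k \<in> borel_measurable borel" using k by (simp add: integrable_iff_bounded)
  have "(LINT y|lborel. wave t y * (\<Sum>x\<in>X. c x * k (y - x))) = (LINT y|lborel. (\<Sum>x\<in>X. c x * (wave t y * k (y - x))))"
    by (simp add: sum_distrib_left mult.left_commute)
  also have "\<dots> = (\<Sum>x\<in>X. c x * (LINT y|lborel. wave t y * k (y - x)))"
    by (subst Bochner_Integration.integral_sum)
       (auto intro!: integrable_mult_right integrable_wave_mult integrable_translate k)
  finally have "fourier (\<lambda>y. \<Sum>x\<in>X. c x * k (y - x)) t = (\<Sum>x\<in>X. c x * fourier (\<lambda>y. k (y - x)) t)"
    by (simp add: fourier_eq sum_distrib_left mult_ac)
  then show ?thesis
    by (simp add: fourier_translate sum_distrib_right mult.assoc)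
qed

text \<open>
  At every point at most one term of the sum is nonzero.
\<close>

lemma norm_sum_packing_sq:
  fixes k :: "'a::real_vector \<Rightarrow> complex"
  assumes X: "finite X" "packing K X" and k: "\<forall>x. x \<notin> K \<longrightarrow> k x = 0"
  shows "(norm (\<Sum>x\<in>X. c x * k (y - x)))\<^sup>2 = (\<Sum>x\<in>X. (norm (c x))\<^sup>2 * (norm (k (y - x)))\<^sup>2)"
proof (cases "\<exists>x\<in>X. y - x \<in> K")
  case True
  then obtain x0 where x0: "x0 \<in> X" "y - x0 \<in> K" by auto
  have z: "k (y - x) = 0" if "x \<in> X" "x \<noteq> x0" for x
  proof -
    have "y - x \<notin> K"
    proof
      assume "y - x \<in> K"
      then have "x + (y - x) \<noteq> x0 + (y - x0)"
        using X(2) x0 that unfolding packing_def by blast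
      then show False by simp
    qed
    then show ?thesis using k by blast
  qed
  have "(\<Sum>x\<in>X. c x * k (y - x)) = c x0 * k (y - x0)"
    using x0 X(1) z by (subst sum.remove[of _ x0]) (auto intro!: sum.neutral)
  moreover have "(\<Sum>x\<in>X. (norm (c x))\<^sup>2 * (norm (k (y - x)))\<^sup>2) = (norm (c x0))\<^sup>2 * (norm (k (y - x0)))\<^sup>2"
    using x0 X(1) z by (subst sum.remove[of _ x0]) (auto intro!: sum.neutral)
  ultimately show ?thesis by (simp add: norm_mult power_mult_distrib)
qed (auto simp: k)

lemma
  fixes X :: "'a::euclidean_space set"
  assumes X: "finite X" "packing K X" and k: "\<forall>x. x \<notin> K \<longrightarrow> k x = 0" and sq: "sq_integrable k"
  shows sq_integrable_sum_translates: "sq_integrable (\<lambda>y. \<Sum>x\<in>X. c x * k (y - x))" (is ?I)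
    and energy_sum_translates: "energy (\<lambda>y. \<Sum>x\<in>X. c x * k (y - x)) = (\<Sum>x\<in>X. (norm (c x))\<^sup>2) * energy k" (is ?E)
proof -
  have [measurable]: "k \<in> borel_measurable borel" using sq by auto
  have i: "integrable lborel (\<lambda>y. (norm (k (y - x)))\<^sup>2)" for x
    using integrable_translate[of "\<lambda>y. (norm (k y))\<^sup>2"] sq by (auto simp: sq_integrable_def)
  have e: "(LINT y|lborel. (norm (k (y - x)))\<^sup>2) = energy k" for x
    using integral_translate[of "\<lambda>y. (norm (k y))\<^sup>2"] by (simp add: energy_def)
  have n: "(norm (\<Sum>x\<in>X. c x * k (y - x)))\<^sup>2 = (\<Sum>x\<in>X. (norm (c x))\<^sup>2 * (norm (k (y - x)))\<^sup>2)" for y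
    by (rule norm_sum_packing_sq[OF X k])
  show ?I unfolding sq_integrable_def n using i by auto
  show ?E unfolding energy_def[of "\<lambda>y. \<Sum>x\<in>X. c x * k (y - x)"] n
    using i by (simp add: e sum_distrib_right)
qed

text \<open>
  The product is the transform of a sum of translates of \<open>k\<close> with disjoint supports. This bounds
  trigonometric sums with frequencies from a packing by the coefficients, with the weight \<open>\<bar>fourier k\<bar>\<^sup>2\<close>.
\<close>

lemma energy_trig_sum_le:
  fixes X :: "'a::euclidean_space set"
  assumes X: "finite X" "packing K X" and k: "\<forall>x. x \<notin> K \<longrightarrow> k x = 0" and sq: "sq_integrable k" and i: "integrable lborel k"
  shows "sq_integrable (\<lambda>t. (\<Sum>x\<in>X. c x * wave t x) * fourier k t)"
    and "energy (\<lambda>t. (\<Sum>x\<in>X. c x * wave t x) * fourier k t) \<le> (\<Sum>x\<in>X. (norm (c x))\<^sup>2) * energy k"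
proof -
  have ii: "integrable lborel (\<lambda>y. \<Sum>x\<in>X. c x * k (y - x))"
    by (intro Bochner_Integration.integrable_sum integrable_mult_right integrable_translate i)
  note sq' = sq_integrable_sum_translates[OF X k sq, of c]
  have eq: "(\<lambda>t. (\<Sum>x\<in>X. c x * wave t x) * fourier k t) = fourier (\<lambda>y. \<Sum>x\<in>X. c x * k (y - x))"
    by (rule ext) (simp only: fourier_sum_translates[OF i])
  show "sq_integrable (\<lambda>t. (\<Sum>x\<in>X. c x * wave t x) * fourier k t)"
    unfolding eq by (rule sq_integrable_fourier[OF ii sq'])
  show "energy (\<lambda>t. (\<Sum>x\<in>X. c x * wave t x) * fourier k t) \<le> (\<Sum>x\<in>X. (norm (c x))\<^sup>2) * energy k"
    using energy_fourier_le[OF ii sq'] unfolding eq energy_sum_translates[OF X k sq, of c] .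
qed

text \<open>
  The density is \<open>\<bar>fourier k\<bar>\<^sup>2\<close>, cut off to \<open>S\<close> and normalised. With \<open>v\<close> the restriction of \<open>fourier k\<close> to \<open>S\<close> and
  \<open>\<rho>\<close> the transform of the density, \<open>A \<rho> x\<close> is the inner product of \<open>v\<close> and the transform of the translate of
  \<open>k\<close> by \<open>x\<close>, up to conjugation. The bound on \<open>\<bar>\<rho>\<bar>\<^sup>2\<close> is Bessel's inequality for these translates.
\<close>

lemma concentrated_spectral_density:
  fixes S K :: "'a::euclidean_space set"
  assumes "admits_concentration S K" and S: "S \<in> sets borel" and K: "bounded K" "K \<in> sets borel"
  obtains w :: "'a \<Rightarrow> real" and M where
    "w \<in> borel_measurable borel" "\<And>t. 0 \<le> w t" "\<And>t. w t \<le> M" "\<And>t. t \<notin> S \<Longrightarrow> w t = 0"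
    "integrable lborel w" "(LINT t|lborel. w t) = 1"
    "\<And>X. finite X \<Longrightarrow> packing K X \<Longrightarrow>
       (\<Sum>x\<in>X. (norm (LINT t|lborel. wave t x * complex_of_real (w t)))\<^sup>2) \<le> (32/17)\<^sup>2"
proof -
  obtain k where sq: "sq_integrable k" and i: "integrable lborel k" and k: "\<forall>x. x \<notin> K \<longrightarrow> k x = 0"
    and k0: "energy k > 0" and le: "(17/32)\<^sup>2 * energy k \<le> energy (\<lambda>t. indicator S t * fourier k t)"
    using concentrated_truncation[OF assms] by blast
  define v where "v = (\<lambda>t. indicator S t * fourier k t)"
  define A where "A = energy v"
  define w where "w = (\<lambda>t. (norm (v t))\<^sup>2 / A)"
  have v: "sq_integrable v" unfolding v_def by (intro sq_integrable_indicator sq_integrable_fourier i sq S)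
  then have [measurable]: "v \<in> borel_measurable borel" by auto
  have "0 < (17/32)\<^sup>2 * energy k" using k0 by simp
  with le have A0: "A > 0" unfolding A_def v_def by (rule less_le_trans[rotated])
  define \<rho> where "\<rho> = (\<lambda>x. LINT t|lborel. wave t x * complex_of_real (w t))"
  define C where "C = fourier_const TYPE('a) * (LINT x|lborel. norm (k x))"
  show thesis
  proof (rule that[of w "C\<^sup>2 / A"])
    show "w \<in> borel_measurable borel" by (simp add: w_def)
    show "0 \<le> w t" for t using A0 by (simp add: w_def)
    show "w t \<le> C\<^sup>2 / A" for t
      unfolding w_def using A0
      by (intro divide_right_mono power_mono)
         (auto simp: v_def indicator_def C_def norm_fourier_le intro: order_trans[OF norm_ge_zero norm_fourier_le])
    show "t \<notin> S \<Longrightarrow> w t = 0" for t by (simp add: w_def v_def)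
    show iw: "integrable lborel w" using v by (simp add: w_def sq_integrable_def)
    show "(LINT t|lborel. w t) = 1"
      using A0 by (simp add: w_def A_def energy_def)
    have iww: "integrable lborel (\<lambda>t. wave t x * complex_of_real (w t))" for x
      by (subst wave_commute, rule integrable_wave_mult) (use iw in \<open>simp add: complex_of_real_integrable_eq\<close>)
    fix X :: "'a set" assume X: "finite X" "packing K X"
    define R where "R = (\<Sum>x\<in>X. (norm (\<rho> x))\<^sup>2)"
    define P where "P t = (\<Sum>x\<in>X. cnj (\<rho> x) * wave t x)" for t
    define u where "u = (\<lambda>t. indicator S t * (P t * fourier k t))"
    note Psq = energy_trig_sum_le[OF X k sq i, of "\<lambda>x. cnj (\<rho> x)", folded P_def]
    have u: "sq_integrable u" unfolding u_def by (rule sq_integrable_indicator[OF Psq(1) S])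
    have Eu: "energy u \<le> R * energy k"
      unfolding u_def R_def using energy_indicator_le[OF Psq(1) S] Psq(2) by simp
    have "(LINT t|lborel. Re (u t * cnj (v t))) = (LINT t|lborel. Re (A * (\<Sum>x\<in>X. cnj (\<rho> x) * (wave t x * complex_of_real (w t)))))"
    proof (intro Bochner_Integration.integral_cong refl arg_cong[where f=Re])
      fix t
      have "u t * cnj (v t) = P t * (v t * cnj (v t))"
        by (simp add: u_def v_def indicator_def)
      also have "\<dots> = A * (P t * complex_of_real (w t))"
        using A0 by (simp add: w_def complex_norm_square[symmetric])
      finally show "u t * cnj (v t) = A * (\<Sum>x\<in>X. cnj (\<rho> x) * (wave t x * complex_of_real (w t)))"
        by (simp add: P_def sum_distrib_right mult.assoc)
    qed
    also have "\<dots> = Re (LINT t|lborel. A * (\<Sum>x\<in>X. cnj (\<rho> x) * (wave t x * complex_of_real (w t))))"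
      by (intro integral_Re integrable_mult_right Bochner_Integration.integrable_sum iww)
    also have "(LINT t|lborel. A * (\<Sum>x\<in>X. cnj (\<rho> x) * (wave t x * complex_of_real (w t)))) = A * (\<Sum>x\<in>X. cnj (\<rho> x) * \<rho> x)"
      unfolding \<rho>_def
      by (subst integral_mult_right_zero, subst Bochner_Integration.integral_sum)
         (simp_all add: iww)
    also have "(\<Sum>x\<in>X. cnj (\<rho> x) * \<rho> x) = complex_of_real R"
      unfolding R_def of_real_sum complex_norm_square by (simp add: mult.commute)
    finally have uv: "(LINT t|lborel. Re (u t * cnj (v t))) = A * R" by simp
    have R0: "R \<ge> 0" by (simp add: R_def sum_nonneg)
    \<comment> \<open>\<open>R v\<close> is the projection of \<open>u\<close> to the line of \<open>v\<close>, as their inner product is \<open>A R\<close>; its energy \<open>A R\<^sup>2\<close> is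
      at most that of \<open>u\<close>.\<close>
    have "0 \<le> energy (\<lambda>t. complex_of_real 1 * u t + complex_of_real (- R) * v t)" by simp
    also have "\<dots> = energy u - A * R\<^sup>2"
      unfolding energy_lincomb[OF u v] uv A_def[symmetric] by (simp add: power2_eq_square)
    finally have "A * R\<^sup>2 \<le> R * energy k" using Eu by simp
    moreover have "(17/32)\<^sup>2 * energy k * R\<^sup>2 \<le> A * R\<^sup>2"
      using le by (intro mult_right_mono) (auto simp: A_def v_def)
    ultimately have "(17/32)\<^sup>2 * energy k * R\<^sup>2 \<le> R * energy k" by linarith
    then have "energy k * R * ((17/32)\<^sup>2 * R - 1) \<le> 0"
      by (simp add: algebra_simps power2_eq_square)
    then have "R \<le> (32/17)\<^sup>2"
      using k0 R0 by (auto simp: mult_le_0_iff power2_eq_square)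
    then show "(\<Sum>x\<in>X. (norm (LINT t|lborel. wave t x * complex_of_real (w t)))\<^sup>2) \<le> (32/17)\<^sup>2"
      by (simp add: R_def \<rho>_def)
  qed
qed

section \<open>Functions with bounded spectrum\<close>

text \<open>
  The spectral density is required to be bounded: with a bounded support it is then integrable as well as square
  integrable, and a convolution of two such densities is bounded again.
\<close>

definition bandlimited :: "'a::euclidean_space set \<Rightarrow> ('a \<Rightarrow> complex) \<Rightarrow> bool" where
  "bandlimited T f \<longleftrightarrow> (\<exists>g M. g \<in> borel_measurable borel \<and> (\<forall>t. norm (g t) \<le> M) \<and>
     (\<forall>t. t \<notin> T \<longrightarrow> g t = 0) \<and> f = fourier g)"

lemma integrable_bounded_support:
  fixes g :: "'a::euclidean_space \<Rightarrow> complex"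
  assumes [measurable]: "g \<in> borel_measurable borel" and M: "\<forall>t. norm (g t) \<le> M"
    and T: "bounded T" "\<forall>t. t \<notin> T \<longrightarrow> g t = 0"
  shows "integrable lborel g"
proof -
  obtain R where R: "T \<subseteq> cball 0 R"
    using T(1) unfolding bounded_iff by (auto simp: subset_eq)
  have i: "integrable lborel (\<lambda>x::'a. M * indicator (cball 0 R) x)"
    by (intro integrable_mult_right integrable_real_indicator emeasure_lborel_cball_finite) auto
  have "norm (g t) \<le> norm (M * indicator (cball 0 R) t)" for t
    using M T(2) R order_trans[OF norm_ge_zero M[rule_format, of t]] by (cases "t \<in> T") (auto simp: indicator_def)
  then show ?thesis
    by (intro Bochner_Integration.integrable_bound[OF i]) auto
qed

lemma bandlimited_mono: "bandlimited T f \<Longrightarrow> T \<subseteq> T' \<Longrightarrow> bandlimited T' f"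
  unfolding bandlimited_def by blast

lemma bandlimited_cmult:
  assumes "bandlimited T f" shows "bandlimited T (\<lambda>x. c * f x)"
proof -
  obtain g M where g: "g \<in> borel_measurable borel" "\<forall>t. norm (g t) \<le> M" "\<forall>t. t \<notin> T \<longrightarrow> g t = 0" "f = fourier g"
    using assms unfolding bandlimited_def by blast
  have "fourier (\<lambda>t. c * g t) = (\<lambda>x. c * f x)"
    by (rule ext) (simp add: g(4) fourier_eq mult.left_commute[of _ c])
  moreover have "norm (c * g t) \<le> norm c * M" for t
    using g(2) by (simp add: norm_mult mult_left_mono)
  ultimately show ?thesis
    unfolding bandlimited_def using g(1,3)
    by (intro exI[of _ "\<lambda>t. c * g t"] exI[of _ "norm c * M"]) auto
qed

lemma bandlimited_add:
  assumes "bandlimited T f" "bandlimited T h" and T: "bounded T"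
  shows "bandlimited T (\<lambda>x. f x + h x)"
proof -
  obtain g M where g: "g \<in> borel_measurable borel" "\<forall>t. norm (g t) \<le> M" "\<forall>t. t \<notin> T \<longrightarrow> g t = 0" "f = fourier g"
    using assms(1) unfolding bandlimited_def by blast
  obtain g' M' where g': "g' \<in> borel_measurable borel" "\<forall>t. norm (g' t) \<le> M'" "\<forall>t. t \<notin> T \<longrightarrow> g' t = 0" "h = fourier g'"
    using assms(2) unfolding bandlimited_def by blast
  have "fourier (\<lambda>t. g t + g' t) = (\<lambda>x. f x + h x)"
    using fourier_lincomb[OF integrable_bounded_support[OF g(1,2) T g(3)] integrable_bounded_support[OF g'(1,2) T g'(3)], of 1 1]
    by (auto simp: g(4) g'(4))
  moreover have "norm (g t + g' t) \<le> M + M'" for t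
    using g(2) g'(2) by (intro norm_triangle_le add_mono) auto
  ultimately show ?thesis
    unfolding bandlimited_def using g(1,3) g'(1,3)
    by (intro exI[of _ "\<lambda>t. g t + g' t"] exI[of _ "M + M'"]) auto
qed

lemma bandlimited_cnj:
  assumes "bandlimited T f" and sym: "origin_symmetric T"
  shows "bandlimited T (\<lambda>x. cnj (f x))"
proof -
  obtain g M where g: "g \<in> borel_measurable borel" "\<forall>t. norm (g t) \<le> M" "\<forall>t. t \<notin> T \<longrightarrow> g t = 0" "f = fourier g"
    using assms(1) unfolding bandlimited_def by blast
  note [measurable] = g(1)
  have [measurable]: "(\<lambda>t. cnj (g (- t))) \<in> borel_measurable borel"
    by (rule measurable_compose[OF _ borel_measurable_continuous_onI[of cnj]]) (auto intro: continuous_intros)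
  have "fourier (\<lambda>t. cnj (g (- t))) x = cnj (f x)" for x
  proof -
    have "(LINT t|lborel. wave x t * cnj (g (- t))) = (LINT t|lborel. cnj (wave x (- t) * g (- t)))"
      by (simp add: cnj_wave)
    also have "\<dots> = cnj (LINT t|lborel. wave x (- t) * g (- t))"
      by (rule Bochner_Integration.integral_cnj)
    also have "(LINT t|lborel. wave x (- t) * g (- t)) = (LINT t|lborel. wave x t * g t)"
      using integral_affine[of "\<lambda>t. wave x t * g t" "-1" 0] by simp
    finally show ?thesis by (simp add: g(4) fourier_eq)
  qed
  then have "(\<lambda>x. cnj (f x)) = fourier (\<lambda>t. cnj (g (- t)))" by auto
  moreover have "t \<notin> T \<longrightarrow> cnj (g (- t)) = 0" for t
    using g(3) sym unfolding origin_symmetric_def by (metis complex_cnj_zero minus_minus)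
  ultimately show ?thesis
    unfolding bandlimited_def using g(2)
    by (intro exI[of _ "\<lambda>t. cnj (g (- t))"] exI[of _ M]) auto
qed

lemma bandlimited_dilate:
  fixes T :: "'a::euclidean_space set"
  assumes "bandlimited T f" and a: "a > 0"
  shows "bandlimited ((\<lambda>t. a *\<^sub>R t) ` T) (\<lambda>x. f (a *\<^sub>R x))"
proof -
  obtain g M where g: "g \<in> borel_measurable borel" "\<forall>t. norm (g t) \<le> M" "\<forall>t. t \<notin> T \<longrightarrow> g t = 0" "f = fourier g"
    using assms(1) unfolding bandlimited_def by blast
  note [measurable] = g(1)
  let ?g = "\<lambda>t. complex_of_real ((1 / a) ^ DIM('a)) * g ((1 / a) *\<^sub>R t)"
  have "fourier ?g x = f (a *\<^sub>R x)" for x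
  proof -
    have "(LINT t|lborel. wave (a *\<^sub>R x) t * g t) =
      (1 / a) ^ DIM('a) *\<^sub>R (LINT t|lborel. wave (a *\<^sub>R x) ((1 / a) *\<^sub>R t) * g ((1 / a) *\<^sub>R t))"
      using integral_affine[of "\<lambda>t. wave (a *\<^sub>R x) t * g t" "1 / a" 0] a by simp
    also have "\<dots> = (LINT t|lborel. wave x t * ?g t)"
      unfolding scaleR_conv_of_real[of "(1 / a) ^ DIM('a)"] integral_mult_right_zero[symmetric]
      using a by (simp add: wave_def mult_ac)
    finally show ?thesis by (simp add: g(4) fourier_eq)
  qed
  moreover have "t \<notin> (\<lambda>t. a *\<^sub>R t) ` T \<longrightarrow> ?g t = 0" for t
  proof
    assume "t \<notin> (\<lambda>t. a *\<^sub>R t) ` T"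
    then have "(1 / a) *\<^sub>R t \<notin> T"
      using a by (auto intro: rev_image_eqI)
    then show "?g t = 0" using g(3) by simp
  qed
  moreover have "norm (?g t) \<le> (1 / a) ^ DIM('a) * M" for t
    using g(2) a by (simp add: norm_mult norm_divide norm_power divide_right_mono power_divide)
  ultimately show ?thesis
    unfolding bandlimited_def
    by (intro exI[of _ ?g] exI[of _ "(1 / a) ^ DIM('a) * M"]) auto
qed

text \<open>
  The spectrum of a product is the convolution of the spectra.
\<close>

lemma bandlimited_mult:
  fixes S T :: "'a::euclidean_space set"
  assumes "bandlimited S f" "bandlimited T h" and bS: "bounded S" and bT: "bounded T"
  shows "bandlimited {s + t |s t. s \<in> S \<and> t \<in> T} (\<lambda>x. f x * h x)"
proof -
  obtain g M where g: "g \<in> borel_measurable borel" "\<forall>t. norm (g t) \<le> M" "\<forall>t. t \<notin> S \<longrightarrow> g t = 0" "f = fourier g"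
    using assms(1) unfolding bandlimited_def by blast
  obtain g' M' where g': "g' \<in> borel_measurable borel" "\<forall>t. norm (g' t) \<le> M'" "\<forall>t. t \<notin> T \<longrightarrow> g' t = 0" "h = fourier g'"
    using assms(2) unfolding bandlimited_def by blast
  note [measurable] = g(1) g'(1)
  have i: "integrable lborel g" by (rule integrable_bounded_support[OF g(1,2) bS g(3)])
  have i': "integrable lborel g'" by (rule integrable_bounded_support[OF g'(1,2) bT g'(3)])
  define c where "c = complex_of_real (fourier_const TYPE('a))"
  define G where "G = (\<lambda>t. c * (LINT s|lborel. g s * g' (t - s)))"
  have [measurable]: "G \<in> borel_measurable borel" unfolding G_def by measurable
  have "fourier G x = f x * h x" for x
  proof -
    have ii: "integrable lborel (\<lambda>t. wave x t * g' (t - s))" for s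
      by (intro integrable_wave_mult integrable_translate i')
    have int: "integrable (lborel \<Otimes>\<^sub>M lborel) (\<lambda>(s, t). g s * (wave x t * g' (t - s)))"
    proof (rule lborel_pair.Fubini_integrable)
      show "AE s in lborel. integrable lborel (\<lambda>t. case (s, t) of (s, t) \<Rightarrow> g s * (wave x t * g' (t - s)))"
        using ii by auto
      have "(LINT t|lborel. norm (g' (t - s))) = (LINT t|lborel. norm (g' t))" for s
        using integral_translate[of "\<lambda>t. norm (g' t)"] by simp
      then show "integrable lborel (\<lambda>s. LINT t|lborel. norm (case (s, t) of (s, t) \<Rightarrow> g s * (wave x t * g' (t - s))))"
        using i by (simp add: norm_mult)
    qed measurable
    have sh: "(LINT t|lborel. wave x t * g' (t - s)) = wave x s * (LINT t|lborel. wave x t * g' t)" for s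
    proof -
      have "(LINT t|lborel. wave x t * g' (t - s)) = (LINT t|lborel. wave x s * (wave x (t - s) * g' (t - s)))"
        by (simp add: mult.assoc[symmetric] wave_add[symmetric])
      also have "\<dots> = wave x s * (LINT t|lborel. wave x t * g' t)"
        by (subst integral_mult_right_zero, subst integral_translate[of "\<lambda>y. wave x y * g' y"]) auto
      finally show ?thesis .
    qed
    have "(LINT t|lborel. (LINT s|lborel. g s * (wave x t * g' (t - s)))) = (LINT s|lborel. (LINT t|lborel. g s * (wave x t * g' (t - s))))"
      using lborel_pair.Fubini_integral[OF int] by simp
    also have "\<dots> = (LINT s|lborel. g s * (wave x s * (LINT t|lborel. wave x t * g' t)))"
      by (simp add: sh)
    also have "\<dots> = (LINT s|lborel. (wave x s * g s) * (LINT t|lborel. wave x t * g' t))"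
      by (simp add: mult_ac)
    also have "\<dots> = (LINT s|lborel. wave x s * g s) * (LINT t|lborel. wave x t * g' t)"
      by (rule integral_mult_left_zero)
    finally have e: "(LINT t|lborel. (LINT s|lborel. g s * (wave x t * g' (t - s)))) =
        (LINT s|lborel. wave x s * g s) * (LINT t|lborel. wave x t * g' t)" .
    have "(LINT t|lborel. wave x t * G t) = (LINT t|lborel. c * (LINT s|lborel. g s * (wave x t * g' (t - s))))"
    proof (intro Bochner_Integration.integral_cong refl)
      fix t
      have "wave x t * (LINT s|lborel. g s * g' (t - s)) = (LINT s|lborel. wave x t * (g s * g' (t - s)))"
        by (rule integral_mult_right_zero[symmetric])
      then show "wave x t * G t = c * (LINT s|lborel. g s * (wave x t * g' (t - s)))"
        by (simp add: G_def mult.left_commute)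
    qed
    also have "\<dots> = c * ((LINT s|lborel. wave x s * g s) * (LINT t|lborel. wave x t * g' t))"
      by (simp only: integral_mult_right_zero e)
    finally show ?thesis
      by (simp add: fourier_eq g(4) g'(4) c_def)
  qed
  moreover have "norm (G t) \<le> norm c * ((LINT s|lborel. norm (g s)) * M')" for t
  proof -
    have "norm (LINT s|lborel. g s * g' (t - s)) \<le> (LINT s|lborel. norm (g s) * M')"
    proof -
      have le: "norm (g s * g' (t - s)) \<le> norm (g s) * M'" for s
        using g'(2) by (simp add: norm_mult mult_left_mono)
      have im: "integrable lborel (\<lambda>s. norm (g s) * M')" using i by auto
      have ig: "integrable lborel (\<lambda>s. g s * g' (t - s))"
        by (rule Bochner_Integration.integrable_bound[OF im])
           (use le in \<open>auto intro: order_trans[OF _ abs_ge_self]\<close>)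
      have "norm (LINT s|lborel. g s * g' (t - s)) \<le> (LINT s|lborel. norm (g s * g' (t - s)))"
        by (rule integral_norm_bound)
      also have "\<dots> \<le> (LINT s|lborel. norm (g s) * M')"
        by (rule integral_mono) (use ig im le in auto)
      finally show ?thesis .
    qed
    then show ?thesis by (simp add: G_def norm_mult mult_left_mono)
  qed
  moreover have "t \<notin> {s + t |s t. s \<in> S \<and> t \<in> T} \<longrightarrow> G t = 0" for t
  proof
    assume t: "t \<notin> {s + t |s t. s \<in> S \<and> t \<in> T}"
    have "g s * g' (t - s) = 0" for s
    proof (cases "s \<in> S \<and> t - s \<in> T")
      case True
      then have "s + (t - s) \<in> {s + t |s t. s \<in> S \<and> t \<in> T}" by blast
      then show ?thesis using t by simp
    qed (use g(3) g'(3) in auto)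
    then show "G t = 0" by (simp only: G_def) simp
  qed
  ultimately show ?thesis
    unfolding bandlimited_def
    by (intro exI[of _ G] exI[of _ "norm c * ((LINT s|lborel. norm (g s)) * M')"]) auto
qed

section \<open>Decay of the correlation away from the body\<close>

text \<open>
  Multiply by a unit \<open>\<alpha>\<close> that makes \<open>\<rho> x\<close> real and let \<open>u = cos \<theta>\<close> be the real part of \<open>\<alpha> wave t x\<close>. Then
  \<open>\<bar>\<rho> x\<bar>\<close> is the mean of \<open>cos \<theta>\<close> and the real part of \<open>\<alpha>\<^sup>2 \<rho> (2 x)\<close> is the mean of \<open>cos (2 \<theta>) = 2 u\<^sup>2 - 1\<close>,
  and the mean of a square is at least the square of the mean.
\<close>

lemma double_angle:
  fixes w :: "'a::euclidean_space \<Rightarrow> real"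
  assumes w: "integrable lborel w" "\<And>t. 0 \<le> w t" "(LINT t|lborel. w t) = 1"
  defines "\<rho> \<equiv> \<lambda>x. LINT t|lborel. wave t x * complex_of_real (w t)"
  shows "2 * (norm (\<rho> x))\<^sup>2 - 1 \<le> norm (\<rho> (2 *\<^sub>R x))"
proof (cases "\<rho> x = 0")
  case True
  then show ?thesis by (simp add: order_trans[OF _ norm_ge_zero])
next
  case False
  define m where "m = norm (\<rho> x)"
  define \<alpha> where "\<alpha> = cnj (\<rho> x) / m"
  define u where "u = (\<lambda>t. Re (\<alpha> * wave t x))"
  have [measurable]: "w \<in> borel_measurable borel" using w(1) by (simp add: integrable_iff_bounded)
  have [measurable]: "u \<in> borel_measurable borel" unfolding u_def by measurable
  have m0: "m > 0" using False by (simp add: m_def)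
  have a1: "norm \<alpha> = 1" using m0 by (simp add: \<alpha>_def m_def norm_divide)
  have az: "\<alpha> * \<rho> x = m"
  proof -
    have "\<alpha> * \<rho> x = complex_of_real (m\<^sup>2) / m"
      unfolding \<alpha>_def m_def complex_norm_square by (simp add: mult.commute)
    then show ?thesis using m0 by (simp add: power2_eq_square)
  qed
  have ew: "integrable lborel (\<lambda>t. complex_of_real (w t))"
    using w(1) by (simp add: complex_of_real_integrable_eq)
  have iw: "integrable lborel (\<lambda>t. wave t y * complex_of_real (w t))" for y
    by (subst wave_commute, rule integrable_wave_mult[OF ew])
  have u1: "\<bar>u t\<bar> \<le> 1" for t
    using abs_Re_le_cmod[of "\<alpha> * wave t x"] by (simp add: u_def norm_mult a1)
  have iu: "integrable lborel (\<lambda>t. u t * w t)"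
    by (rule Bochner_Integration.integrable_bound[OF w(1)])
       (use u1 w(2) in \<open>auto simp: abs_mult intro!: mult_left_le_one_le\<close>)
  have iu2: "integrable lborel (\<lambda>t. (u t)\<^sup>2 * w t)"
    by (rule Bochner_Integration.integrable_bound[OF w(1)])
       (use u1 w(2) in \<open>auto simp: abs_mult abs_square_le_1 intro!: mult_left_le_one_le\<close>)
  have "(LINT t|lborel. u t * w t) = (LINT t|lborel. Re (\<alpha> * (wave t x * complex_of_real (w t))))"
    by (simp add: u_def algebra_simps)
  also have "\<dots> = Re (\<alpha> * \<rho> x)"
    unfolding integral_Re[OF integrable_mult_right[OF iw[of x], of \<alpha>]] by (simp only: \<rho>_def integral_mult_right_zero)
  finally have U1: "(LINT t|lborel. u t * w t) = m" using az by simp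
  have sq: "Re ((\<alpha> * wave t x)\<^sup>2) = 2 * (u t)\<^sup>2 - 1" for t
  proof -
    have "(norm (\<alpha> * wave t x))\<^sup>2 = 1" by (simp add: norm_mult a1)
    then show ?thesis
      unfolding u_def cmod_power2 by (simp add: power2_eq_square)
  qed
  have "(LINT t|lborel. 2 * ((u t)\<^sup>2 * w t) - w t) = (LINT t|lborel. Re (\<alpha>\<^sup>2 * (wave t (2 *\<^sub>R x) * complex_of_real (w t))))"
  proof (intro Bochner_Integration.integral_cong refl)
    fix t
    have "\<alpha>\<^sup>2 * (wave t (2 *\<^sub>R x) * complex_of_real (w t)) = (\<alpha> * wave t x)\<^sup>2 * complex_of_real (w t)"
      by (simp add: scaleR_2 wave_add power2_eq_square mult_ac)
    moreover have "Re (z * complex_of_real c) = Re z * c" for z c by simp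
    ultimately have "Re (\<alpha>\<^sup>2 * (wave t (2 *\<^sub>R x) * complex_of_real (w t))) = Re ((\<alpha> * wave t x)\<^sup>2) * w t"
      by (simp only:)
    then show "2 * ((u t)\<^sup>2 * w t) - w t = Re (\<alpha>\<^sup>2 * (wave t (2 *\<^sub>R x) * complex_of_real (w t)))"
      unfolding sq by (simp add: algebra_simps)
  qed
  also have "\<dots> = Re (\<alpha>\<^sup>2 * \<rho> (2 *\<^sub>R x))"
    unfolding integral_Re[OF integrable_mult_right[OF iw[of "2 *\<^sub>R x"], of "\<alpha>\<^sup>2"]]
    by (simp only: \<rho>_def integral_mult_right_zero)
  also have "\<dots> \<le> norm (\<alpha>\<^sup>2 * \<rho> (2 *\<^sub>R x))" by (rule complex_Re_le_cmod)
  also have "\<dots> = norm (\<rho> (2 *\<^sub>R x))" by (simp add: norm_mult norm_power a1)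
  finally have le: "2 * (LINT t|lborel. (u t)\<^sup>2 * w t) - 1 \<le> norm (\<rho> (2 *\<^sub>R x))"
    using iu2 w by simp
  have "0 \<le> (LINT t|lborel. (u t - m)\<^sup>2 * w t)"
    using w(2) by simp
  also have "(\<lambda>t. (u t - m)\<^sup>2 * w t) = (\<lambda>t. (u t)\<^sup>2 * w t - 2 * m * (u t * w t) + m\<^sup>2 * w t)"
    by (auto simp: power2_diff algebra_simps)
  also have "(LINT t|lborel. (u t)\<^sup>2 * w t - 2 * m * (u t * w t) + m\<^sup>2 * w t) = (LINT t|lborel. (u t)\<^sup>2 * w t) - m\<^sup>2"
    using iu iu2 w U1 by (simp add: power2_eq_square)
  finally show ?thesis using le by (simp add: m_def)
qed

lemma symmetric_convex_scaleR:
  assumes K: "convex K" "origin_symmetric K" and a: "a \<in> K" "\<bar>c\<bar> \<le> 1"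
  shows "c *\<^sub>R a \<in> K"
proof -
  have "((1 + c) / 2) *\<^sub>R a + ((1 - c) / 2) *\<^sub>R (- a) \<in> K"
    using K a by (intro convexD) (auto simp: origin_symmetric_def field_simps abs_le_iff)
  moreover have "((1 + c) / 2) *\<^sub>R a + ((1 - c) / 2) *\<^sub>R (- a) = c *\<^sub>R a"
    by (simp add: scaleR_left.diff[symmetric] field_simps flip: scaleR_minus_left scaleR_left.add)
  ultimately show ?thesis by simp
qed

text \<open>
  If \<open>x\<close> is no difference of two points of \<open>K\<close>, neither is a nonzero integer multiple of \<open>x\<close>, by shrinking
  these points towards the origin.
\<close>

lemma packing_multiples:
  fixes x :: "'a::euclidean_space"
  assumes K: "convex K" "origin_symmetric K" and x: "packing K {0, x}" "x \<noteq> 0"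
  shows "packing K (range (\<lambda>j::int. real_of_int j *\<^sub>R x))"
  unfolding packing_def
proof (safe)
  fix i j :: int and a b assume ne: "real_of_int i *\<^sub>R x \<noteq> real_of_int j *\<^sub>R x" and ab: "a \<in> K" "b \<in> K"
    and eq: "real_of_int i *\<^sub>R x + a = real_of_int j *\<^sub>R x + b"
  define n where "n = real_of_int (i - j)"
  have "i \<noteq> j" using ne by auto
  then have n: "n \<noteq> 0" "\<bar>1 / n\<bar> \<le> 1" by (auto simp: n_def abs_divide field_simps)
  have "n *\<^sub>R x = b - a" using eq by (simp add: n_def algebra_simps)
  then have "x = (1 / n) *\<^sub>R (b - a)" using n(1) by (metis divideR_right divide_inverse mult_1 inverse_eq_divide)
  then have "x + (1 / n) *\<^sub>R a = 0 + (1 / n) *\<^sub>R b" by (simp add: scaleR_diff_right)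
  moreover have "(1 / n) *\<^sub>R a \<in> K" "(1 / n) *\<^sub>R b \<in> K"
    using symmetric_convex_scaleR[OF K _ n(2)] ab by auto
  ultimately show False using x unfolding packing_def by blast
qed

text \<open>
  \<open>25 r T\<^sub>2 (12 r / 5 - 1)\<close>, where \<open>T\<^sub>2 (y) = 2 y\<^sup>2 - 1\<close> is the Chebyshev polynomial and the affine map takes
  \<open>[0, 5/6]\<close> onto \<open>[-1, 1]\<close>. It takes the value \<open>73\<close> at \<open>1\<close>.
\<close>

definition chebyshev_cubic :: "real \<Rightarrow> real" where
  "chebyshev_cubic r = 288 * r ^ 3 - 240 * r\<^sup>2 + 25 * r"

text \<open>
  The bound \<open>\<bar>T\<^sub>2\<bar> \<le> 1\<close> on \<open>[-1, 1]\<close>.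
\<close>

lemma chebyshev_cubic_le:
  fixes r :: real
  assumes "0 \<le> r" "r \<le> 5/6"
  shows "\<bar>chebyshev_cubic r\<bar> \<le> 25 * r"
proof -
  have e: "chebyshev_cubic r = r * (288 * r\<^sup>2 - 240 * r + 25)"
    by (simp add: chebyshev_cubic_def power2_eq_square power3_eq_cube algebra_simps)
  have "0 \<le> 2 * (12 * r - 5)\<^sup>2" by simp
  also have "\<dots> = 288 * r\<^sup>2 - 240 * r + 50" by (simp add: power2_eq_square algebra_simps)
  finally have 1: "- 25 \<le> 288 * r\<^sup>2 - 240 * r + 25" by simp
  have "288 * (r * r) \<le> 288 * (5/6 * r)" using assms by (intro mult_left_mono mult_right_mono) auto
  then have 2: "288 * r\<^sup>2 - 240 * r + 25 \<le> 25" by (simp add: power2_eq_square)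
  have "\<bar>288 * r\<^sup>2 - 240 * r + 25\<bar> \<le> 25" using 1 2 by (simp add: abs_le_iff)
  from mult_left_mono[OF this assms(1)] show ?thesis unfolding e abs_mult using assms(1) by (simp add: mult.commute)
qed

text \<open>
  Abstracts from the concentrated function: the decay of \<open>\<rho>\<close> away from \<open>2 K\<close> follows from Bessel's inequality along
  packings and from the symmetry and convexity of \<open>K\<close>.
\<close>

locale spectral_density =
  fixes K :: "'a::euclidean_space set" and w :: "'a \<Rightarrow> real"
  assumes K: "convex K" "origin_symmetric K" "K \<noteq> {}"
    and w: "integrable lborel w" "\<And>t. 0 \<le> w t" "(LINT t|lborel. w t) = 1"
    and bessel: "\<And>X. finite X \<Longrightarrow> packing K X \<Longrightarrow>
       (\<Sum>x\<in>X. (norm (LINT t|lborel. wave t x * complex_of_real (w t)))\<^sup>2) \<le> (32/17)\<^sup>2"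
begin

definition \<rho> :: "'a \<Rightarrow> complex" where
  "\<rho> x = (LINT t|lborel. wave t x * complex_of_real (w t))"

definition r :: "'a \<Rightarrow> real" where "r x = (norm (\<rho> x))\<^sup>2"

lemma r_nonneg [simp]: "r x \<ge> 0" by (simp add: r_def)

lemma r_0 [simp]: "r 0 = 1"
  by (simp add: r_def \<rho>_def w(3))

lemma r_minus [simp]: "r (- x) = r x"
proof -
  have "\<rho> (- x) = (LINT t|lborel. cnj (wave t x * complex_of_real (w t)))"
    by (simp add: \<rho>_def cnj_wave)
  also have "\<dots> = cnj (\<rho> x)" unfolding \<rho>_def by (rule Bochner_Integration.integral_cnj)
  finally show ?thesis by (simp add: r_def)
qed

lemma sum_r_le: "finite X \<Longrightarrow> packing K X \<Longrightarrow> sum r X \<le> (32/17)\<^sup>2"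
  unfolding r_def[abs_def] \<rho>_def by (rule bessel)

text \<open>
  If \<open>r x > 5/6\<close>, then \<open>r (2 x) \<ge> (2 \<sqdot> 5/6 - 1)\<^sup>2 = 4/9\<close> by \<open>double_angle\<close>, and the sum of \<open>r\<close> over
  \<open>{0, \<plusminus>x, \<plusminus>2x}\<close> exceeds \<open>1 + 5/3 + 8/9 > 3.55 > (32/17)\<^sup>2\<close>.
\<close>

lemma r_le:
  assumes x: "packing K {0, x}" "x \<noteq> 0"
  shows "r x \<le> 5/6"
proof (rule ccontr)
  assume "\<not> r x \<le> 5/6"
  then have gt: "r x > 5/6" by simp
  have inj: "inj (\<lambda>j::int. real_of_int j *\<^sub>R x)" using x(2) by (auto simp: inj_on_def)
  have "packing K ((\<lambda>j::int. real_of_int j *\<^sub>R x) ` {-2..2})"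
    by (rule packing_subset[OF packing_multiples[OF K(1,2) x]]) auto
  from sum_r_le[OF _ this] have "(\<Sum>j\<in>{-2..2::int}. r (real_of_int j *\<^sub>R x)) \<le> (32/17)\<^sup>2"
    by (simp add: sum.reindex[OF inj_on_subset[OF inj subset_UNIV]] o_def)
  moreover have "{-2..2::int} = {-2, -1, 0, 1, 2}" by auto
  ultimately have le: "1 + 2 * r x + 2 * r (2 *\<^sub>R x) \<le> (32/17)\<^sup>2"
    using r_minus[of x] r_minus[of "2 *\<^sub>R x"] by simp
  have "2/3 \<le> 2 * r x - 1" using gt by simp
  also have "\<dots> \<le> norm (\<rho> (2 *\<^sub>R x))"
    unfolding r_def \<rho>_def by (rule double_angle[OF w])
  finally have "(2/3)\<^sup>2 \<le> r (2 *\<^sub>R x)" unfolding r_def by (intro power_mono) auto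
  then show False using le gt by (simp add: power2_eq_square)
qed

text \<open>
  Compare with \<open>chebyshev_cubic (r 0) = 73\<close>: along a packing the value at the centre dominates all others together.
\<close>

lemma sum_chebyshev_cubic_le:
  assumes X: "finite X" "packing K X" "y \<in> X"
  shows "(\<Sum>x\<in>X - {y}. \<bar>chebyshev_cubic (r (x - y))\<bar>) \<le> 64"
proof -
  let ?Y = "(\<lambda>x. x - y) ` X"
  have pY: "packing K ?Y"
    using X(2) unfolding packing_def by (auto simp: algebra_simps)
  have "\<bar>chebyshev_cubic (r (x - y))\<bar> \<le> 25 * r (x - y)" if "x \<in> X - {y}" for x
  proof (intro chebyshev_cubic_le r_le packing_subset[OF pY])
    show "{0, x - y} \<subseteq> ?Y" using that X(3) by (force intro: rev_image_eqI)
  qed (use that in auto)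
  then have "(\<Sum>x\<in>X - {y}. \<bar>chebyshev_cubic (r (x - y))\<bar>) \<le> 25 * (\<Sum>x\<in>X - {y}. r (x - y))"
    unfolding sum_distrib_left by (intro sum_mono)
  moreover have "(\<Sum>x\<in>X. r (x - y)) = 1 + (\<Sum>x\<in>X - {y}. r (x - y))"
    using X by (subst sum.remove[of _ y]) auto
  moreover have "(\<Sum>x\<in>X. r (x - y)) \<le> (32/17)\<^sup>2"
    using sum_r_le[OF _ pY] X(1) by (simp add: sum.reindex inj_on_def o_def)
  ultimately show ?thesis by (simp add: power2_eq_square)
qed

end

section \<open>The interpolation kernel\<close>

lemma dilates_add:
  assumes S: "convex S" and ab: "a \<ge> 0" "b \<ge> 0"
    and x: "x \<in> (\<lambda>t. a *\<^sub>R t) ` S" and y: "y \<in> (\<lambda>t. b *\<^sub>R t) ` S"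
  shows "x + y \<in> (\<lambda>t. (a + b) *\<^sub>R t) ` S"
proof -
  obtain s t where s: "s \<in> S" "x = a *\<^sub>R s" and t: "t \<in> S" "y = b *\<^sub>R t" using x y by auto
  show ?thesis
  proof (cases "a + b = 0")
    case True
    then have "a = 0" "b = 0" using ab by auto
    then show ?thesis using s t by auto
  next
    case False
    then have p: "a + b > 0" using ab by auto
    have "(a / (a + b)) *\<^sub>R s + (b / (a + b)) *\<^sub>R t \<in> S"
      using S s t ab p by (intro convexD) (auto simp: add_divide_distrib[symmetric])
    moreover have "x + y = (a + b) *\<^sub>R ((a / (a + b)) *\<^sub>R s + (b / (a + b)) *\<^sub>R t)"
      using p s t by (simp add: scaleR_add_right)
    ultimately show ?thesis by blast
  qed
qed

lemma bandlimited_mult_dilates: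
  fixes S :: "'a::euclidean_space set"
  assumes S: "convex S" "bounded S" and ab: "a \<ge> 0" "b \<ge> 0"
    and f: "bandlimited ((\<lambda>t. a *\<^sub>R t) ` S) f" and h: "bandlimited ((\<lambda>t. b *\<^sub>R t) ` S) h"
  shows "bandlimited ((\<lambda>t. (a + b) *\<^sub>R t) ` S) (\<lambda>x. f x * h x)"
  using bandlimited_mult[OF f h bounded_scaling[OF S(2)] bounded_scaling[OF S(2)]]
  by (rule bandlimited_mono) (use dilates_add[OF S(1) ab] in blast)

text \<open>
  The cubic of \<open>r\<close> has its spectrum in \<open>6 S\<close>. Dilating by \<open>1/6\<close> brings the spectrum into \<open>S\<close> and replaces
  the packing condition for \<open>K\<close> by that for \<open>6 K\<close>.
\<close>

lemma interpolation_kernel: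
  fixes S K :: "'a::euclidean_space set"
  assumes S: "convex_body S" "origin_symmetric S" and K: "convex_body K" "origin_symmetric K"
    and conc: "admits_concentration S K"
  obtains \<phi> :: "'a \<Rightarrow> complex" where "bandlimited S \<phi>" "\<phi> 0 = 1" "\<And>x. norm (\<phi> (- x)) = norm (\<phi> x)"
    "\<And>X y. finite X \<Longrightarrow> packing ((\<lambda>x. 6 *\<^sub>R x) ` K) X \<Longrightarrow> y \<in> X \<Longrightarrow>
       (\<Sum>x\<in>X - {y}. norm (\<phi> (x - y))) \<le> 64/73"
proof -
  have cS: "convex S" "compact S" "bounded S" "S \<noteq> {}" and cK: "convex K" "compact K" "bounded K" "K \<noteq> {}"
    using S(1) K(1) by (auto simp: convex_body_def intro: compact_imp_bounded)
  have bS: "S \<in> sets borel" "K \<in> sets borel" using cS cK by (simp_all add: borel_compact)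
  obtain w :: "'a \<Rightarrow> real" and M where
    wS: "w \<in> borel_measurable borel" "\<And>t. 0 \<le> w t" "\<And>t. w t \<le> M" "\<And>t. t \<notin> S \<Longrightarrow> w t = 0"
    "integrable lborel w" "(LINT t|lborel. w t) = 1"
    and bessel: "\<And>X. finite X \<Longrightarrow> packing K X \<Longrightarrow>
       (\<Sum>x\<in>X. (norm (LINT t|lborel. wave t x * complex_of_real (w t)))\<^sup>2) \<le> (32/17)\<^sup>2"
    by (rule concentrated_spectral_density[OF conc bS(1) cK(3) bS(2)], rule that)
  interpret spectral_density K w
    by (unfold_locales; (fact cK(1) K(2) cK(4) wS(5) wS(2) wS(6) | rule bessel; assumption))
  define D where "D a = (\<lambda>t. a *\<^sub>R t) ` S" for a :: real
  have D_mono: "D a \<subseteq> S" if "0 \<le> a" "a \<le> 1" for a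
    unfolding D_def using symmetric_convex_scaleR[OF cS(1) S(2)] that by auto
  have D_mult: "bandlimited (D (a + b)) (\<lambda>x. f x * h x)"
    if "a \<ge> 0" "b \<ge> 0" "bandlimited (D a) f" "bandlimited (D b) h" for a b f h
    using bandlimited_mult_dilates[OF cS(1,3) that(1,2)] that(3,4) unfolding D_def by blast
  have sym: "origin_symmetric (D a)" for a
    unfolding D_def origin_symmetric_def
  proof safe
    fix t assume "t \<in> S"
    then show "- (a *\<^sub>R t) \<in> (\<lambda>t. a *\<^sub>R t) ` S"
      using S(2) by (intro image_eqI[of _ _ "- t"]) (auto simp: origin_symmetric_def)
  qed
  have fw: "bandlimited S (fourier (\<lambda>t. complex_of_real (w t)))"
    unfolding bandlimited_def using wS by (intro exI[of _ "\<lambda>t. complex_of_real (w t)"] exI[of _ M]) auto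
  have "fourier (\<lambda>t. complex_of_real (w t)) x = complex_of_real (fourier_const TYPE('a)) * \<rho> x" for x
    unfolding fourier_eq \<rho>_def by (subst wave_commute) (rule refl)
  then have "(\<lambda>x. 1 / complex_of_real (fourier_const TYPE('a)) * fourier (\<lambda>t. complex_of_real (w t)) x) = \<rho>"
    by (intro ext) (simp add: less_imp_neq[OF fourier_const_pos, symmetric])
  with bandlimited_cmult[OF fw, of "1 / complex_of_real (fourier_const TYPE('a))"]
  have "bandlimited S \<rho>" by simp
  from bandlimited_dilate[OF this, of "1/6"]
  have 1: "bandlimited (D (1/6)) (\<lambda>x. \<rho> ((1/6) *\<^sub>R x))" by (simp add: D_def)
  define R where "R x = complex_of_real (r ((1/6) *\<^sub>R x))" for x
  have R: "R x = \<rho> ((1/6) *\<^sub>R x) * cnj (\<rho> ((1/6) *\<^sub>R x))" for x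
    by (simp only: R_def r_def complex_norm_square)
  have R1: "bandlimited (D (1/3)) R"
    using D_mult[OF _ _ 1 bandlimited_cnj[OF 1 sym]] unfolding R[symmetric] by simp
  have R2: "bandlimited (D (2/3)) (\<lambda>x. R x * R x)"
    using D_mult[OF _ _ R1 R1] by simp
  have R3: "bandlimited (D 1) (\<lambda>x. (R x * R x) * R x)"
    using D_mult[OF _ _ R2 R1] by simp
  define \<phi> where "\<phi> x = complex_of_real (chebyshev_cubic (r ((1/6) *\<^sub>R x)) / 73)" for x
  have b1: "bandlimited S R" by (rule bandlimited_mono[OF R1 D_mono]) auto
  have b2: "bandlimited S (\<lambda>x. R x * R x)" by (rule bandlimited_mono[OF R2 D_mono]) auto
  have b3: "bandlimited S (\<lambda>x. (R x * R x) * R x)" by (rule bandlimited_mono[OF R3 D_mono]) auto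
  have "bandlimited S (\<lambda>x. (288/73 * ((R x * R x) * R x) + (- 240/73) * (R x * R x)) + 25/73 * R x)"
    by (rule bandlimited_add[OF bandlimited_add[OF bandlimited_cmult[OF b3] bandlimited_cmult[OF b2] cS(3)]
        bandlimited_cmult[OF b1] cS(3)])
  moreover have "(288/73 * ((R x * R x) * R x) + (- 240/73) * (R x * R x)) + 25/73 * R x = \<phi> x" for x
    unfolding \<phi>_def R_def chebyshev_cubic_def power2_eq_square power3_eq_cube
    by (simp add: diff_divide_distrib add_divide_distrib mult.assoc)
  ultimately have "bandlimited S \<phi>" by simp
  moreover have "\<phi> 0 = 1" by (simp add: \<phi>_def chebyshev_cubic_def)
  moreover have "norm (\<phi> (- x)) = norm (\<phi> x)" for x by (simp add: \<phi>_def)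
  moreover have "(\<Sum>x\<in>X - {y}. norm (\<phi> (x - y))) \<le> 64/73"
    if X: "finite X" "packing ((\<lambda>x. 6 *\<^sub>R x) ` K) X" "y \<in> X" for X y
  proof -
    let ?g = "\<lambda>x::'a. (1/6) *\<^sub>R x"
    have inj: "inj_on ?g A" for A by (auto simp: inj_on_def)
    have pk: "packing K (?g ` X)"
      unfolding packing_def
    proof (safe)
      fix x y a b assume xy: "x \<in> X" "y \<in> X" "?g x \<noteq> ?g y" "a \<in> K" "b \<in> K" and e: "?g x + a = ?g y + b"
      have "x + 6 *\<^sub>R a = 6 *\<^sub>R (?g x + a)" by (simp add: scaleR_add_right)
      also have "\<dots> = y + 6 *\<^sub>R b" unfolding e by (simp add: scaleR_add_right)
      finally have "x + 6 *\<^sub>R a = y + 6 *\<^sub>R b" .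
      moreover have "x \<noteq> y" using xy(3) by auto
      moreover have "6 *\<^sub>R a \<in> (\<lambda>x. 6 *\<^sub>R x) ` K" "6 *\<^sub>R b \<in> (\<lambda>x. 6 *\<^sub>R x) ` K"
        using xy(4,5) by (simp_all only: imageI)
      ultimately show False using X(2)[unfolded packing_def, rule_format, OF xy(1,2)] by metis
    qed
    have "?g ` X - {?g y} = ?g ` (X - {y})"
      using image_set_diff[OF inj[of UNIV], of X "{y}"] by (simp only: image_insert image_empty)
    with sum_chebyshev_cubic_le[OF finite_imageI[OF X(1)] pk imageI[OF X(3)]]
    have "(\<Sum>x\<in>X - {y}. \<bar>chebyshev_cubic (r (?g (x - y)))\<bar>) \<le> 64"
      by (simp only: sum.reindex[OF inj] o_def scaleR_diff_right)
    moreover have "(\<Sum>x\<in>X - {y}. norm (\<phi> (x - y))) = (\<Sum>x\<in>X - {y}. \<bar>chebyshev_cubic (r (?g (x - y)))\<bar>) / 73"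
      unfolding sum_divide_distrib by (intro sum.cong refl) (simp only: \<phi>_def norm_of_real abs_divide abs_numeral)
    ultimately show ?thesis by simp
  qed
  ultimately show thesis by (rule that)
qed

section \<open>Trigonometric sums and diagonal dominance\<close>

lemma cos_ge_half: "\<bar>y\<bar> \<le> 1 \<Longrightarrow> 1/2 \<le> cos (y::real)"
proof -
  assume y: "\<bar>y\<bar> \<le> 1"
  have "cos (pi / 3) \<le> cos \<bar>y\<bar>"
    by (rule cos_monotone_0_pi_le) (use y pi_gt3 in auto)
  then show ?thesis by (simp add: cos_60)
qed

lemma indicator_complex: "(indicator A :: 'a \<Rightarrow> complex) = (\<lambda>x. complex_of_real (indicator A x))"
  by (auto simp: indicator_def)

text \<open>
  On the ball the real part of the character is at least \<open>cos 1 \<ge> 1/2\<close>.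
\<close>

lemma fourier_indicator_ball_ge:
  fixes t :: "'a::euclidean_space"
  assumes e: "e > 0" "e * norm t \<le> 1"
  shows "fourier_const TYPE('a) * (measure lborel (ball (0::'a) e) / 2) \<le> norm (fourier (indicator (ball 0 e)) t)"
proof -
  let ?B = "ball (0::'a) e"
  have iB: "integrable lborel (indicator ?B :: 'a \<Rightarrow> real)"
    by (intro integrable_real_indicator emeasure_lborel_ball_finite) auto
  then have iBc: "integrable lborel (indicator ?B :: 'a \<Rightarrow> complex)"
    unfolding indicator_complex by (simp only: complex_of_real_integrable_eq)
  have "measure lborel ?B / 2 = (LINT x|lborel. indicator ?B x / 2)"
    by simp
  also have "\<dots> \<le> (LINT x|lborel. Re (wave t x * indicator ?B x))"
  proof (rule integral_mono)
    show "integrable lborel (\<lambda>x. indicator ?B x / 2 :: real)" using iB by auto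
    show "integrable lborel (\<lambda>x. Re (wave t x * indicator ?B x))"
      using integrable_wave_mult[OF iBc, of t] by (rule integrable_Re)
    fix x
    have "1/2 \<le> cos (t \<bullet> x)" if "x \<in> ?B"
    proof (rule cos_ge_half)
      have "\<bar>t \<bullet> x\<bar> \<le> norm t * norm x" by (rule Cauchy_Schwarz_ineq2)
      also have "\<dots> \<le> norm t * e" using that by (intro mult_left_mono) auto
      finally show "\<bar>t \<bullet> x\<bar> \<le> 1" using e by (simp add: mult.commute)
    qed
    then show "indicator ?B x / 2 \<le> Re (wave t x * indicator ?B x)"
      by (cases "x \<in> ?B") (simp_all add: wave_def)
  qed
  also have "\<dots> = Re (LINT x|lborel. wave t x * indicator ?B x)"
    by (rule integral_Re[OF integrable_wave_mult[OF iBc]])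
  also have "\<dots> \<le> norm (LINT x|lborel. wave t x * indicator ?B x)"
    by (rule complex_Re_le_cmod)
  finally show ?thesis
    by (simp add: fourier_eq norm_mult mult_left_mono less_imp_le)
qed

text \<open>
  On the bounded set \<open>S\<close> the multiplier \<open>g\<close> is dominated by the transform of the indicator function of a sufficiently
  small ball, for which \<open>energy_trig_sum_le\<close> applies.
\<close>

lemma energy_trig_multiplier_le:
  fixes S \<Lambda> :: "'a::euclidean_space set"
  assumes S: "bounded S" and \<Lambda>: "packing (ball 0 \<epsilon>) \<Lambda>" "\<epsilon> > 0"
    and g: "g \<in> borel_measurable borel" "\<forall>t. norm (g t) \<le> M" "\<forall>t. t \<notin> S \<longrightarrow> g t = 0"
  obtains C where "C \<ge> 0"
    "\<And>L c. finite L \<Longrightarrow> L \<subseteq> \<Lambda> \<Longrightarrow> sq_integrable (\<lambda>t. g t * (\<Sum>l\<in>L. c l * wave t (- l))) \<and>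
        energy (\<lambda>t. g t * (\<Sum>l\<in>L. c l * wave t (- l))) \<le> C\<^sup>2 * (\<Sum>l\<in>L. (norm (c l))\<^sup>2)"
proof -
  obtain R where R: "R > 0" "\<And>t. t \<in> S \<Longrightarrow> norm t \<le> R"
    using S unfolding bounded_pos by blast
  define e where "e = min \<epsilon> (1 / R)"
  have e: "e > 0" "e \<le> \<epsilon>" "e * R \<le> 1"
    using \<Lambda>(2) R(1) by (auto simp: e_def min_def field_simps)
  define k where "k = (indicator (ball 0 e) :: 'a \<Rightarrow> complex)"
  have bk: "k \<in> borel_measurable borel" unfolding k_def by (rule borel_measurable_indicator) (simp add: borel_open)
  have kn: "(norm (k x))\<^sup>2 = indicator (ball 0 e) x" for x by (simp add: k_def indicator_def)
  have sqk: "sq_integrable k"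
    unfolding sq_integrable_def kn using bk
    by (auto intro!: integrable_real_indicator emeasure_lborel_ball_finite)
  have k0: "\<forall>x. x \<notin> ball 0 e \<longrightarrow> k x = 0" by (simp add: k_def)
  have ik: "integrable lborel k"
    by (rule sq_integrable_imp_integrable[OF sqk bounded_ball[of 0 e]]) (use k0 in auto)
  define \<delta> where "\<delta> = fourier_const TYPE('a) * (measure lborel (ball (0::'a) e) / 2)"
  have d0: "\<delta> > 0"
    using content_ball_pos[OF e(1), of "0::'a"] by (simp add: \<delta>_def)
  have d: "\<delta> \<le> norm (fourier k t)" if "t \<in> S" for t
    unfolding \<delta>_def k_def
  proof (rule fourier_indicator_ball_ge[OF e(1)])
    have "e * norm t \<le> e * R" using R(2)[OF that] e(1) by (intro mult_left_mono) auto
    then show "e * norm t \<le> 1" using e(3) by simp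
  qed
  have M0: "M \<ge> 0" using g(2) norm_ge_zero order_trans by blast
  define C where "C = M / \<delta> * sqrt (energy k)"
  show thesis
  proof (rule that[of C])
    show "C \<ge> 0" using M0 d0 by (simp add: C_def)
    fix L and c :: "'a \<Rightarrow> complex" assume L: "finite L" "L \<subseteq> \<Lambda>"
    define P where "P t = (\<Sum>l\<in>L. c l * wave t (- l))" for t
    define Q where "Q t = (\<Sum>l\<in>L. cnj (c l) * wave t l)" for t
    have "ball 0 e \<subseteq> ball (0::'a) \<epsilon>" using e(2) by auto
    then have pL: "packing (ball 0 e) L"
      using packing_mono[OF packing_subset[OF \<Lambda>(1) L(2)]] by blast
    have PQ: "P t = cnj (Q t)" for t by (simp add: P_def Q_def cnj_wave)
    note E = energy_trig_sum_le[OF L(1) pL k0 sqk ik, of "\<lambda>l. cnj (c l)", folded Q_def]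
    let ?h = "\<lambda>t. complex_of_real (M / \<delta>) * (Q t * fourier k t)"
    have le: "norm (g t * P t) \<le> norm (?h t)" for t
    proof (cases "t \<in> S")
      case True
      have "\<delta> * norm (g t) \<le> norm (fourier k t) * M"
        using d[OF True] g(2) d0 by (intro mult_mono) auto
      then have "norm (g t) \<le> M / \<delta> * norm (fourier k t)" using d0 by (simp add: field_simps)
      then have "norm (g t) * norm (Q t) \<le> M / \<delta> * norm (fourier k t) * norm (Q t)"
        by (rule mult_right_mono) simp
      then show ?thesis using M0 d0 by (simp add: PQ norm_mult norm_divide mult_ac)
    qed (use g(3) in simp)
    have sqh: "sq_integrable ?h" by (rule sq_integrable_cmult[OF E(1)])
    have [measurable]: "g \<in> borel_measurable borel" by (rule g)
    have "(\<lambda>t. g t * P t) \<in> borel_measurable borel" unfolding P_def by measurable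
    from sq_integrable_le[OF this sqh le] have sq: "sq_integrable (\<lambda>t. g t * P t)" .
    have "energy (\<lambda>t. g t * P t) \<le> energy ?h"
      unfolding energy_def using sq sqh le
      by (intro integral_mono power_mono) (auto simp: sq_integrable_def)
    also have "\<dots> = (M / \<delta>)\<^sup>2 * energy (\<lambda>t. Q t * fourier k t)"
      unfolding energy_def using M0 d0 by (simp add: norm_mult norm_divide power_mult_distrib power_divide)
    also have "\<dots> \<le> (M / \<delta>)\<^sup>2 * ((\<Sum>l\<in>L. (norm (cnj (c l)))\<^sup>2) * energy k)"
      by (intro mult_left_mono E(2)) auto
    also have "\<dots> = C\<^sup>2 * (\<Sum>l\<in>L. (norm (c l))\<^sup>2)"
      by (simp add: C_def power_mult_distrib power_divide mult_ac)
    finally show "sq_integrable (\<lambda>t. g t * (\<Sum>l\<in>L. c l * wave t (- l))) \<and>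
        energy (\<lambda>t. g t * (\<Sum>l\<in>L. c l * wave t (- l))) \<le> C\<^sup>2 * (\<Sum>l\<in>L. (norm (c l))\<^sup>2)"
      using sq unfolding P_def by simp
  qed
qed

lemma schur_test:
  fixes a :: "'a \<Rightarrow> 'a \<Rightarrow> real"
  assumes fin: "finite X" "finite L" and a: "\<And>x l. a x l \<ge> 0" and q: "q \<ge> 0"
    and row: "\<And>x. x \<in> X \<Longrightarrow> (\<Sum>l\<in>L. a x l) \<le> q" and col: "\<And>l. l \<in> L \<Longrightarrow> (\<Sum>x\<in>X. a x l) \<le> q"
  shows "L2_set (\<lambda>x. \<Sum>l\<in>L. a x l * b l) X \<le> q * L2_set b L"
proof -
  have "(\<Sum>x\<in>X. (\<Sum>l\<in>L. a x l * b l)\<^sup>2) \<le> (\<Sum>x\<in>X. q * (\<Sum>l\<in>L. a x l * (b l)\<^sup>2))"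
  proof (rule sum_mono)
    fix x assume x: "x \<in> X"
    have "(\<Sum>l\<in>L. a x l * b l)\<^sup>2 = (\<Sum>l\<in>L. sqrt (a x l) * (sqrt (a x l) * b l))\<^sup>2"
      using a by (simp add: mult.assoc[symmetric])
    also have "\<dots> \<le> (\<Sum>l\<in>L. (sqrt (a x l))\<^sup>2) * (\<Sum>l\<in>L. (sqrt (a x l) * b l)\<^sup>2)"
      by (rule Cauchy_Schwarz_ineq_sum)
    also have "\<dots> = (\<Sum>l\<in>L. a x l) * (\<Sum>l\<in>L. a x l * (b l)\<^sup>2)"
      using a by (simp add: power_mult_distrib)
    also have "\<dots> \<le> q * (\<Sum>l\<in>L. a x l * (b l)\<^sup>2)"
      using row[OF x] a by (intro mult_right_mono sum_nonneg) auto
    finally show "(\<Sum>l\<in>L. a x l * b l)\<^sup>2 \<le> q * (\<Sum>l\<in>L. a x l * (b l)\<^sup>2)" .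
  qed
  also have "\<dots> = q * (\<Sum>l\<in>L. (\<Sum>x\<in>X. a x l) * (b l)\<^sup>2)"
    unfolding sum_distrib_left[symmetric] sum_distrib_right by (subst sum.swap) (rule refl)
  also have "\<dots> \<le> q * (\<Sum>l\<in>L. q * (b l)\<^sup>2)"
    using col q by (intro mult_left_mono sum_mono mult_right_mono) auto
  also have "\<dots> = (q * L2_set b L)\<^sup>2"
    by (simp add: L2_set_def sum_nonneg power_mult_distrib sum_distrib_left[symmetric] power2_eq_square[of q])
  finally show ?thesis
    unfolding L2_set_def using q by (intro real_le_lsqrt) (auto simp: L2_set_def sum_nonneg)
qed

text \<open>
  The finite set \<open>L\<close> nearly attains the supremum of the finite square sums.
\<close>

lemma L2_set_tail:
  fixes c :: "'a \<Rightarrow> real"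
  assumes bd: "\<And>X. finite X \<Longrightarrow> X \<subseteq> \<Lambda> \<Longrightarrow> L2_set c X \<le> B" and B: "B \<ge> 0" and \<eta>: "\<eta> > 0"
  obtains L where "finite L" "L \<subseteq> \<Lambda>" "\<And>X. finite X \<Longrightarrow> X \<subseteq> \<Lambda> - L \<Longrightarrow> L2_set c X \<le> \<eta> * B"
proof (cases "B = 0")
  case True
  then show thesis using that[of "{}"] bd by auto
next
  case False
  define s where "s X = (\<Sum>x\<in>X. (c x)\<^sup>2)" for X
  let ?F = "{X. finite X \<and> X \<subseteq> \<Lambda>}"
  have s: "s X \<le> B\<^sup>2" if "X \<in> ?F" for X
    using bd[of X] that B unfolding L2_set_def s_def by (auto dest: sqrt_le_D)
  have bdd: "bdd_above (s ` ?F)" using s by (intro bdd_aboveI[of _ "B\<^sup>2"]) auto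
  have neF: "?F \<noteq> {}" by (auto intro: exI[of _ "{}"])
  have "(SUP X\<in>?F. s X) - (\<eta> * B)\<^sup>2 < (SUP X\<in>?F. s X)" using False \<eta> by simp
  then obtain L where L: "L \<in> ?F" "(SUP X\<in>?F. s X) - (\<eta> * B)\<^sup>2 < s L"
    using iffD1[OF less_cSUP_iff[OF neF bdd]] by blast
  show thesis
  proof (rule that[of L])
    fix X assume X: "finite X" "X \<subseteq> \<Lambda> - L"
    have "s (L \<union> X) \<le> (SUP X\<in>?F. s X)"
      by (rule cSUP_upper[OF _ bdd]) (use X L in auto)
    moreover have "s (L \<union> X) = s L + s X"
      unfolding s_def by (rule sum.union_disjoint) (use X L in auto)
    ultimately have "s X \<le> (\<eta> * B)\<^sup>2" using L(2) by linarith
    then show "L2_set c X \<le> \<eta> * B"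
      unfolding L2_set_def s_def using \<eta> B by (intro real_le_lsqrt) (auto simp: sum_nonneg)
  qed (use L in auto)
qed

lemma L2_set_mono_set: "finite Y \<Longrightarrow> X \<subseteq> Y \<Longrightarrow> L2_set c X \<le> L2_set c Y"
  unfolding L2_set_def by (intro real_sqrt_le_mono sum_mono2) auto

section \<open>Successive approximation\<close>

lemma fourier_modulated_sum:
  assumes g: "integrable lborel g"
  shows "fourier (\<lambda>t. g t * (\<Sum>l\<in>L. c l * wave t (- l))) x = (\<Sum>l\<in>L. c l * fourier g (x - l))"
proof -
  have "wave x t * (g t * (\<Sum>l\<in>L. c l * wave t (- l))) = (\<Sum>l\<in>L. c l * (wave (x - l) t * g t))" for t
  proof -
    have "wave (x - l) t = wave x t * wave t (- l)" for l
      using wave_diff[of t x l] by (simp add: wave_commute)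
    then show ?thesis by (simp add: sum_distrib_left mult_ac)
  qed
  then have "(LINT t|lborel. wave x t * (g t * (\<Sum>l\<in>L. c l * wave t (- l)))) = (\<Sum>l\<in>L. c l * (LINT t|lborel. wave (x - l) t * g t))"
    by (simp add: Bochner_Integration.integral_sum integrable_wave_mult[OF g])
  then show ?thesis by (simp add: fourier_eq sum_distrib_left mult_ac)
qed

text \<open>
  Interpolate the values on a finite set that carries almost all of \<open>c\<close> by translates of \<open>\<phi>\<close>. The error consists of the
  neglected tail, which gives \<open>\<eta>\<close>, and of the influence of each node on the others, which \<open>schur_test\<close> bounds by \<open>q\<close>.
  With finitely many nodes the spectrum of the approximation is an explicit finite sum.
\<close>

lemma approximate_interpolation:
  fixes S \<Lambda> :: "'a::euclidean_space set"
  assumes S: "bounded S" and \<Lambda>: "packing (ball 0 \<epsilon>) \<Lambda>" "\<epsilon> > 0"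
    and \<phi>: "bandlimited S \<phi>" "\<phi> 0 = 1" "\<And>x. norm (\<phi> (- x)) = norm (\<phi> x)"
    and q: "q \<ge> 0" "\<And>X y. finite X \<Longrightarrow> X \<subseteq> \<Lambda> \<Longrightarrow> y \<in> X \<Longrightarrow> (\<Sum>x\<in>X - {y}. norm (\<phi> (x - y))) \<le> q"
    and \<eta>: "\<eta> > 0"
  obtains C where "C \<ge> 0"
    "\<And>c B. B \<ge> 0 \<Longrightarrow> (\<And>X. finite X \<Longrightarrow> X \<subseteq> \<Lambda> \<Longrightarrow> L2_set (\<lambda>l. norm (c l)) X \<le> B) \<Longrightarrow>
       \<exists>H. sq_integrable H \<and> (\<forall>t. t \<notin> S \<longrightarrow> H t = 0) \<and> energy H \<le> (C * B)\<^sup>2 \<and>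
         (\<forall>X. finite X \<longrightarrow> X \<subseteq> \<Lambda> \<longrightarrow> L2_set (\<lambda>l. norm (c l - fourier H l)) X \<le> (q + \<eta>) * B)"
proof -
  obtain g M where g: "g \<in> borel_measurable borel" "\<forall>t. norm (g t) \<le> M" "\<forall>t. t \<notin> S \<longrightarrow> g t = 0" "\<phi> = fourier g"
    using \<phi>(1) unfolding bandlimited_def by blast
  have ig: "integrable lborel g" by (rule integrable_bounded_support[OF g(1,2) S g(3)])
  obtain C where C: "C \<ge> 0"
    "\<And>L c. finite L \<Longrightarrow> L \<subseteq> \<Lambda> \<Longrightarrow> sq_integrable (\<lambda>t. g t * (\<Sum>l\<in>L. c l * wave t (- l))) \<and>
        energy (\<lambda>t. g t * (\<Sum>l\<in>L. c l * wave t (- l))) \<le> C\<^sup>2 * (\<Sum>l\<in>L. (norm (c l))\<^sup>2)"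
    by (rule energy_trig_multiplier_le[OF S \<Lambda> g(1,2,3)], rule that)
  show thesis
  proof (rule that[OF C(1)])
    fix c :: "'a \<Rightarrow> complex" and B :: real
    assume B: "B \<ge> 0" and bd: "\<And>X. finite X \<Longrightarrow> X \<subseteq> \<Lambda> \<Longrightarrow> L2_set (\<lambda>l. norm (c l)) X \<le> B"
    obtain L where L: "finite L" "L \<subseteq> \<Lambda>"
      and tail: "\<And>X. finite X \<Longrightarrow> X \<subseteq> \<Lambda> - L \<Longrightarrow> L2_set (\<lambda>l. norm (c l)) X \<le> \<eta> * B"
      by (rule L2_set_tail[of \<Lambda> "\<lambda>l. norm (c l)" B \<eta>, OF _ B \<eta>], rule bd, assumption, assumption, rule that)
    define H where "H = (\<lambda>t. g t * (\<Sum>l\<in>L. c l * wave t (- l)))"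
    note CL = C(2)[OF L, of c, folded H_def]
    have fH: "fourier H x = (\<Sum>l\<in>L. c l * \<phi> (x - l))" for x
      unfolding H_def fourier_modulated_sum[OF ig] g(4) ..
    have "(\<Sum>l\<in>L. (norm (c l))\<^sup>2) = (L2_set (\<lambda>l. norm (c l)) L)\<^sup>2"
      by (simp add: L2_set_def sum_nonneg)
    also have "\<dots> \<le> B\<^sup>2" by (intro power_mono bd L) (simp add: L2_set_nonneg)
    finally have "C\<^sup>2 * (\<Sum>l\<in>L. (norm (c l))\<^sup>2) \<le> (C * B)\<^sup>2"
      by (simp add: power_mult_distrib mult_left_mono)
    then have EH: "energy H \<le> (C * B)\<^sup>2" using CL by linarith
    have res: "L2_set (\<lambda>l. norm (c l - fourier H l)) X \<le> (q + \<eta>) * B" if X: "finite X" "X \<subseteq> \<Lambda>" for X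
    proof -
      define Y where "Y = X \<union> L"
      have Y: "finite Y" "Y \<subseteq> \<Lambda>" "X \<subseteq> Y" "L \<subseteq> Y" using X L by (auto simp: Y_def)
      \<comment> \<open>The moduli of the off-diagonal entries of the interpolation matrix.\<close>
      define a where "a x l = (if x = l then 0 else norm (\<phi> (x - l)))" for x l
      have a_sym: "a x l = a l x" for x l
        using \<phi>(3)[of "x - l"] by (simp add: a_def)
      have a0: "a x l \<ge> 0" for x l by (simp add: a_def)
      have colY: "(\<Sum>x\<in>Y. a x l) \<le> q" if "l \<in> Y" for l
      proof -
        have "(\<Sum>x\<in>Y. a x l) = (\<Sum>x\<in>Y - {l}. norm (\<phi> (x - l)))"
          using Y(1) that by (subst sum.remove[of _ l]) (auto simp: a_def intro!: sum.cong)
        then show ?thesis using q(2)[OF Y(1,2) that] by simp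
      qed
      have rowL: "(\<Sum>l\<in>L. a x l) \<le> q" if "x \<in> Y" for x
      proof -
        have "(\<Sum>l\<in>L. a x l) \<le> (\<Sum>l\<in>Y. a l x)"
          unfolding a_sym[of x] by (intro sum_mono2 Y a0)
        then show ?thesis using colY[OF that] by simp
      qed
      let ?d = "\<lambda>x. if x \<in> L then 0 else norm (c x)"
      have pt: "norm (c x - fourier H x) \<le> ?d x + (\<Sum>l\<in>L. a x l * norm (c l))" for x
      proof -
        define c' where "c' l = (if x = l then 0 else c l * \<phi> (x - l))" for l
        have "(\<Sum>l\<in>L. c l * \<phi> (x - l)) = (if x \<in> L then c x else 0) + (\<Sum>l\<in>L. c' l)"
        proof (cases "x \<in> L")
          case True
          then have "(\<Sum>l\<in>L. c l * \<phi> (x - l)) = c x + (\<Sum>l\<in>L - {x}. c l * \<phi> (x - l))"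
            using L(1) \<phi>(2) by (subst sum.remove[of _ x]) auto
          also have "(\<Sum>l\<in>L - {x}. c l * \<phi> (x - l)) = (\<Sum>l\<in>L - {x}. c' l)"
            by (intro sum.cong) (auto simp: c'_def)
          also have "\<dots> = (\<Sum>l\<in>L. c' l)"
            using L(1) True by (subst (2) sum.remove[of _ x]) (auto simp: c'_def)
          finally show ?thesis using True by simp
        qed (auto simp: c'_def intro!: sum.cong)
        then have "c x - fourier H x = (if x \<in> L then 0 else c x) - (\<Sum>l\<in>L. c' l)"
          by (simp add: fH)
        also have "norm \<dots> \<le> norm (if x \<in> L then 0 else c x) + norm (\<Sum>l\<in>L. c' l)"
          by (rule norm_triangle_ineq4)
        also have "norm (\<Sum>l\<in>L. c' l) \<le> (\<Sum>l\<in>L. a x l * norm (c l))"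
          by (rule sum_norm_le) (simp add: c'_def a_def norm_mult)
        finally show ?thesis by (simp add: if_distrib[of norm] cong: if_cong)
      qed
      have "L2_set (\<lambda>l. norm (c l - fourier H l)) X \<le> L2_set (\<lambda>l. norm (c l - fourier H l)) Y"
        by (rule L2_set_mono_set[OF Y(1,3)])
      also have "\<dots> \<le> L2_set (\<lambda>x. ?d x + (\<Sum>l\<in>L. a x l * norm (c l))) Y"
        by (rule L2_set_mono) (use pt in auto)
      also have "\<dots> \<le> L2_set ?d Y + L2_set (\<lambda>x. \<Sum>l\<in>L. a x l * norm (c l)) Y"
        by (rule L2_set_triangle_ineq)
      also have "L2_set ?d Y = L2_set (\<lambda>l. norm (c l)) (Y - L)"
        unfolding L2_set_def
        by (intro arg_cong[where f=sqrt] sum.mono_neutral_cong_right) (use Y in auto)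
      also have "\<dots> \<le> \<eta> * B" by (rule tail) (use Y in auto)
      also have "L2_set (\<lambda>x. \<Sum>l\<in>L. a x l * norm (c l)) Y \<le> q * L2_set (\<lambda>l. norm (c l)) L"
        by (rule schur_test[OF Y(1) L(1) a0 q(1)]) (use rowL colY Y in auto)
      also have "\<dots> \<le> q * B" by (intro mult_left_mono bd L q(1))
      finally show ?thesis by (simp add: algebra_simps)
    qed
    show "\<exists>H. sq_integrable H \<and> (\<forall>t. t \<notin> S \<longrightarrow> H t = 0) \<and> energy H \<le> (C * B)\<^sup>2 \<and>
         (\<forall>X. finite X \<longrightarrow> X \<subseteq> \<Lambda> \<longrightarrow> L2_set (\<lambda>l. norm (c l - fourier H l)) X \<le> (q + \<eta>) * B)"
      using CL EH res g(3) by (intro exI[of _ H]) (auto simp: H_def)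
  qed
qed

text \<open>
  The Cauchy--Schwarz inequality with geometric weights.
\<close>

lemma sum_sq_geometric_le:
  fixes y :: "nat \<Rightarrow> real"
  assumes \<theta>: "0 < \<theta>" "\<theta> < 1"
  shows "(\<Sum>n<N. y n)\<^sup>2 \<le> (1 / (1 - \<theta>)) * (\<Sum>n<N. (y n)\<^sup>2 / \<theta> ^ n)"
proof -
  have "(\<Sum>n<N. y n)\<^sup>2 = (\<Sum>n<N. sqrt (\<theta> ^ n) * (y n / sqrt (\<theta> ^ n)))\<^sup>2"
    using \<theta> by simp
  also have "\<dots> \<le> (\<Sum>n<N. (sqrt (\<theta> ^ n))\<^sup>2) * (\<Sum>n<N. (y n / sqrt (\<theta> ^ n))\<^sup>2)"
    by (rule Cauchy_Schwarz_ineq_sum)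
  also have "\<dots> = (\<Sum>n<N. \<theta> ^ n) * (\<Sum>n<N. (y n)\<^sup>2 / \<theta> ^ n)"
    using \<theta> by (simp add: power_divide)
  also have "\<dots> \<le> (1 / (1 - \<theta>)) * (\<Sum>n<N. (y n)\<^sup>2 / \<theta> ^ n)"
  proof (rule mult_right_mono)
    have "(\<Sum>n<N. \<theta> ^ n) \<le> (\<Sum>n. \<theta> ^ n)"
      by (rule sum_le_suminf) (use \<theta> in \<open>auto intro: summable_geometric\<close>)
    also have "\<dots> = 1 / (1 - \<theta>)" using \<theta> by (simp add: suminf_geometric)
    finally show "(\<Sum>n<N. \<theta> ^ n) \<le> 1 / (1 - \<theta>)" .
    show "0 \<le> (\<Sum>n<N. (y n)\<^sup>2 / \<theta> ^ n)" using \<theta> by (intro sum_nonneg) auto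
  qed
  finally show ?thesis .
qed

text \<open>
  The weighted sum \<open>\<Sum>n. \<bar>H n t\<bar>\<^sup>2 / \<theta> ^ n\<close> has a finite integral, hence is finite almost everywhere. It dominates
  the series itself: it gives absolute convergence almost everywhere, and by \<open>sum_sq_geometric_le\<close> it bounds the
  square of the sum.
\<close>

lemma sq_integrable_geometric_series:
  fixes H :: "nat \<Rightarrow> 'a::euclidean_space \<Rightarrow> complex"
  assumes S: "bounded S" and H: "\<And>n. sq_integrable (H n)" "\<And>n t. t \<notin> S \<Longrightarrow> H n t = 0"
    and E: "\<And>n. energy (H n) \<le> (D * \<theta> ^ n)\<^sup>2" and \<theta>: "0 < \<theta>" "\<theta> < 1"
  obtains G where "sq_integrable G" "\<And>t. t \<notin> S \<Longrightarrow> G t = 0"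
    "\<And>x. (\<lambda>n. fourier (H n) x) sums fourier G x"
proof -
  have [measurable]: "H n \<in> borel_measurable borel" for n using H(1) by auto
  define y where "y n t = norm (H n t)" for n t
  define Q where "Q n t = (y n t)\<^sup>2 / \<theta> ^ n" for n t
  define G where "G t = (\<Sum>n. H n t)" for t
  define T where "T = D\<^sup>2 / (1 - \<theta>)"
  have [measurable]: "G \<in> borel_measurable borel" "Q n \<in> borel_measurable borel" for n
    unfolding G_def Q_def y_def by measurable
  have Q0: "Q n t \<ge> 0" for n t using \<theta> by (simp add: Q_def)
  have Qi: "integrable lborel (Q n)" for n
    using H(1)[of n] unfolding Q_def y_def sq_integrable_def by auto
  have QE: "(LINT t|lborel. Q n t) \<le> D\<^sup>2 * \<theta> ^ n" for n
  proof -
    have "(LINT t|lborel. Q n t) = energy (H n) / \<theta> ^ n" by (simp add: Q_def y_def energy_def)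
    also have "\<dots> \<le> (D * \<theta> ^ n)\<^sup>2 / \<theta> ^ n" using \<theta> E by (intro divide_right_mono) auto
    also have "\<dots> = D\<^sup>2 * \<theta> ^ n" using \<theta> by (simp add: power2_eq_square)
    finally show ?thesis .
  qed
  have gs: "summable (\<lambda>n. c * \<theta> ^ n)" for c
    using \<theta> by (intro summable_mult summable_geometric) auto
  have "(\<integral>\<^sup>+t. (\<Sum>n. ennreal (Q n t)) \<partial>lborel) = (\<Sum>n. \<integral>\<^sup>+t. ennreal (Q n t) \<partial>lborel)"
    by (rule nn_integral_suminf) measurable
  also have "\<dots> \<le> (\<Sum>n. ennreal (D\<^sup>2 * \<theta> ^ n))"
    using QE Q0 Qi by (intro suminf_le) (auto simp: nn_integral_eq_integral intro: ennreal_leI)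
  also have "\<dots> = ennreal (\<Sum>n. D\<^sup>2 * \<theta> ^ n)"
    by (rule suminf_ennreal2) (use \<theta> gs in auto)
  also have "(\<Sum>n. D\<^sup>2 * \<theta> ^ n) = T"
    using \<theta> by (subst suminf_mult) (auto simp: T_def suminf_geometric intro: summable_geometric)
  finally have QT: "(\<integral>\<^sup>+t. (\<Sum>n. ennreal (Q n t)) \<partial>lborel) \<le> ennreal T" .
  have "AE t in lborel. (\<Sum>n. ennreal (Q n t)) \<noteq> \<infinity>"
    by (rule nn_integral_PInf_AE) (use QT in \<open>auto simp: top_unique\<close>)
  then have sQ: "AE t in lborel. summable (\<lambda>n. Q n t)"
    by eventually_elim (rule summable_suminf_not_top, use Q0 in auto)
  have yQ: "y n t \<le> \<theta> ^ n + Q n t" for n t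
  proof (cases "y n t \<le> \<theta> ^ n")
    case False
    then have "y n t * \<theta> ^ n \<le> y n t * y n t" by (intro mult_left_mono) (auto simp: y_def)
    then have "y n t \<le> Q n t" using \<theta> by (simp add: Q_def field_simps power2_eq_square)
    then show ?thesis using \<theta> by (simp add: add_increasing)
  qed (use Q0[of n t] in simp)
  have sy: "summable (\<lambda>n. y n t)" if "summable (\<lambda>n. Q n t)" for t
    by (rule summable_comparison_test'[where g="\<lambda>n. 1 * \<theta> ^ n + Q n t" and N=0])
       (use yQ that gs[of 1] in \<open>auto intro!: summable_add simp: y_def\<close>)
  have G2: "(norm (G t))\<^sup>2 \<le> (1 / (1 - \<theta>)) * (\<Sum>n. Q n t)" if s: "summable (\<lambda>n. Q n t)" for t
  proof -
    have "norm (G t) \<le> (\<Sum>n. y n t)"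
      unfolding G_def y_def by (rule summable_norm) (use sy[OF s] in \<open>simp add: y_def\<close>)
    then have "(norm (G t))\<^sup>2 \<le> (\<Sum>n. y n t)\<^sup>2" by (intro power_mono) auto
    also have "\<dots> \<le> (1 / (1 - \<theta>)) * (\<Sum>n. Q n t)"
    proof (rule LIMSEQ_le_const2)
      show "(\<lambda>N. (\<Sum>n<N. y n t)\<^sup>2) \<longlonglongrightarrow> (\<Sum>n. y n t)\<^sup>2"
        by (intro tendsto_power summable_LIMSEQ sy s)
      have "(\<Sum>n<N. y n t)\<^sup>2 \<le> (1 / (1 - \<theta>)) * (\<Sum>n. Q n t)" for N
      proof -
        have "(\<Sum>n<N. y n t)\<^sup>2 \<le> (1 / (1 - \<theta>)) * (\<Sum>n<N. Q n t)"
          unfolding Q_def by (rule sum_sq_geometric_le[OF \<theta>])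
        also have "\<dots> \<le> (1 / (1 - \<theta>)) * (\<Sum>n. Q n t)"
          using \<theta> Q0 by (intro mult_left_mono sum_le_suminf s) auto
        finally show ?thesis .
      qed
      then show "\<exists>M. \<forall>N\<ge>M. (\<Sum>n<N. y n t)\<^sup>2 \<le> (1 / (1 - \<theta>)) * (\<Sum>n. Q n t)" by blast
    qed
    finally show ?thesis .
  qed
  have "(\<integral>\<^sup>+t. ennreal ((norm (G t))\<^sup>2) \<partial>lborel) \<le> (\<integral>\<^sup>+t. ennreal (1 / (1 - \<theta>)) * (\<Sum>n. ennreal (Q n t)) \<partial>lborel)"
  proof (rule nn_integral_mono_AE, use sQ in eventually_elim)
    fix t assume s: "summable (\<lambda>n. Q n t)"
    have "ennreal ((norm (G t))\<^sup>2) \<le> ennreal ((1 / (1 - \<theta>)) * (\<Sum>n. Q n t))"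
      by (rule ennreal_leI[OF G2[OF s]])
    also have "\<dots> = ennreal (1 / (1 - \<theta>)) * ennreal (\<Sum>n. Q n t)"
      by (rule ennreal_mult) (use \<theta> Q0 s in \<open>auto intro: suminf_nonneg\<close>)
    also have "ennreal (\<Sum>n. Q n t) = (\<Sum>n. ennreal (Q n t))"
      by (rule suminf_ennreal2[symmetric]) (use Q0 s in auto)
    finally show "ennreal ((norm (G t))\<^sup>2) \<le> ennreal (1 / (1 - \<theta>)) * (\<Sum>n. ennreal (Q n t))" .
  qed
  also have "\<dots> = ennreal (1 / (1 - \<theta>)) * (\<integral>\<^sup>+t. (\<Sum>n. ennreal (Q n t)) \<partial>lborel)"
    by (rule nn_integral_cmult) measurable
  also have "\<dots> \<le> ennreal (1 / (1 - \<theta>)) * ennreal T" by (intro mult_left_mono QT) auto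
  also have "\<dots> = ennreal (1 / (1 - \<theta>) * T)"
    by (rule ennreal_mult[symmetric]) (use \<theta> in \<open>auto simp: T_def\<close>)
  finally have sqG: "sq_integrable G" by (intro sq_integrableI) auto
  have iH: "integrable lborel (H n)" for n
    by (rule sq_integrable_imp_integrable[OF H(1) S]) (use H(2) in auto)
  obtain R where R: "S \<subseteq> cball 0 R"
    using S unfolding bounded_iff by (auto simp: subset_eq)
  let ?I = "\<lambda>t::'a. indicator (cball 0 R) t :: real"
  have iI: "integrable lborel ?I"
    by (intro integrable_real_indicator emeasure_lborel_cball_finite) auto
  have ny: "(LINT t|lborel. norm (H n t)) \<le> (integral\<^sup>L lborel ?I + D\<^sup>2) * \<theta> ^ n" for n
  proof -
    have "(LINT t|lborel. norm (H n t)) \<le> (LINT t|lborel. \<theta> ^ n * ?I t + Q n t)"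
    proof (rule integral_mono)
      show "integrable lborel (\<lambda>t. norm (H n t))" using iH by auto
      show "integrable lborel (\<lambda>t. \<theta> ^ n * ?I t + Q n t)" using iI Qi by auto
      fix t
      show "norm (H n t) \<le> \<theta> ^ n * ?I t + Q n t"
        using yQ[of n t] R H(2)[of t n] Q0[of n t] \<theta> by (cases "t \<in> S") (auto simp: y_def indicator_def)
    qed
    also have "\<dots> = \<theta> ^ n * integral\<^sup>L lborel ?I + (LINT t|lborel. Q n t)" using iI Qi by simp
    also have "\<dots> \<le> \<theta> ^ n * integral\<^sup>L lborel ?I + D\<^sup>2 * \<theta> ^ n" using QE by simp
    finally show ?thesis by (simp add: algebra_simps)
  qed
  have sums: "(\<lambda>n. fourier (H n) x) sums fourier G x" for x
  proof -
    have s1: "AE t in lborel. summable (\<lambda>n. norm (wave x t * H n t))"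
      using sQ by eventually_elim (use sy in \<open>simp add: norm_mult y_def\<close>)
    have s2: "summable (\<lambda>n. LINT t|lborel. norm (wave x t * H n t))"
      by (rule summable_comparison_test'[OF gs[of "integral\<^sup>L lborel ?I + D\<^sup>2"], where N=0])
         (use ny in \<open>simp add: norm_mult\<close>)
    have "(\<lambda>n. LINT t|lborel. wave x t * H n t) sums (LINT t|lborel. (\<Sum>n. wave x t * H n t))"
      by (rule sums_integral[OF integrable_wave_mult[OF iH] s1 s2])
    also have "(LINT t|lborel. (\<Sum>n. wave x t * H n t)) = (LINT t|lborel. wave x t * G t)"
    proof (rule integral_cong_AE)
      show "AE t in lborel. (\<Sum>n. wave x t * H n t) = wave x t * G t"
        using sQ
      proof eventually_elim
        case (elim t)
        have "summable (\<lambda>n. H n t)"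
          by (rule summable_norm_cancel) (use sy[OF elim] in \<open>simp add: y_def\<close>)
        then show ?case unfolding G_def by (rule suminf_mult)
      qed
    qed measurable
    finally show ?thesis unfolding fourier_eq by (rule sums_mult)
  qed
  have "G t = 0" if "t \<notin> S" for t unfolding G_def using H(2)[OF that] by simp
  then show thesis using that sqG sums by blast
qed

section \<open>Interpolation\<close>

lemma countable_packing_ball:
  fixes \<Lambda> :: "'a::euclidean_space set"
  assumes p: "packing (ball 0 \<epsilon>) \<Lambda>" and e: "\<epsilon> > 0"
  shows "countable \<Lambda>"
proof (rule countable_image_inj_on)
  have dj: "ball x \<epsilon> \<inter> ball y \<epsilon> = {}" if "x \<in> \<Lambda>" "y \<in> \<Lambda>" "x \<noteq> y" for x y
  proof -
    have False if z: "z \<in> ball x \<epsilon>" "z \<in> ball y \<epsilon>" for z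
    proof -
      have "z - x \<in> ball 0 \<epsilon>" "z - y \<in> ball 0 \<epsilon>"
        using z by (simp_all add: dist_norm norm_minus_commute)
      then have "x + (z - x) \<noteq> y + (z - y)"
        using p \<open>x \<in> \<Lambda>\<close> \<open>y \<in> \<Lambda>\<close> \<open>x \<noteq> y\<close> unfolding packing_def by blast
      then show False by simp
    qed
    then show ?thesis by blast
  qed
  show "countable ((\<lambda>x. ball x \<epsilon>) ` \<Lambda>)"
    by (rule countable_disjoint_open_subsets) (auto simp: pairwise_def disjnt_def dest: dj)
  show "inj_on (\<lambda>x. ball x \<epsilon>) \<Lambda>"
  proof (rule inj_onI, rule ccontr)
    fix x y assume "x \<in> \<Lambda>" "y \<in> \<Lambda>" "ball x \<epsilon> = ball y \<epsilon>" "x \<noteq> y"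
    then have "ball x \<epsilon> = {}" using dj[of x y] by simp
    then show False using e by (simp add: ball_eq_empty)
  qed
qed

text \<open>
  Iterate \<open>approximate_interpolation\<close> on the remaining error. The \<open>n\<close>-th error and the \<open>n\<close>-th correction
  decrease like \<open>\<theta> ^ n\<close>, and the partial sums of the values telescope.
\<close>

lemma interpolation_from_kernel:
  fixes S \<Lambda> :: "'a::euclidean_space set"
  assumes S: "bounded S" and \<Lambda>: "packing (ball 0 \<epsilon>) \<Lambda>" "\<epsilon> > 0"
    and \<phi>: "bandlimited S \<phi>" "\<phi> 0 = 1" "\<And>x. norm (\<phi> (- x)) = norm (\<phi> x)"
    and q: "q \<ge> 0" "q < 1" "\<And>X y. finite X \<Longrightarrow> X \<subseteq> \<Lambda> \<Longrightarrow> y \<in> X \<Longrightarrow> (\<Sum>x\<in>X - {y}. norm (\<phi> (x - y))) \<le> q"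
  shows "interpolation_set \<Lambda> (paley_wiener S)"
  unfolding interpolation_set_def
proof (intro conjI allI impI)
  show "countable \<Lambda>" by (rule countable_packing_ball[OF \<Lambda>])
  fix c :: "'a \<Rightarrow> complex"
  assume c: "(\<lambda>l. (norm (c l))\<^sup>2) summable_on \<Lambda>"
  define \<eta> where "\<eta> = (1 - q) / 2"
  define \<theta> where "\<theta> = q + \<eta>"
  have \<eta>: "\<eta> > 0" and \<theta>: "0 < \<theta>" "\<theta> < 1" using q(1,2) by (auto simp: \<eta>_def \<theta>_def field_simps)
  define B where "B = sqrt (infsum (\<lambda>l. (norm (c l))\<^sup>2) \<Lambda>)"
  have B0: "B \<ge> 0" by (simp add: B_def infsum_nonneg)
  define bounded_by where "bounded_by b d \<longleftrightarrow> (\<forall>X. finite X \<longrightarrow> X \<subseteq> \<Lambda> \<longrightarrow> L2_set (\<lambda>l. norm (d l)) X \<le> b)" for b :: real and d :: "'a \<Rightarrow> complex"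
  have cB: "bounded_by B c"
    unfolding bounded_by_def B_def L2_set_def
    using c by (auto intro!: real_sqrt_le_mono finite_sum_le_infsum)
  obtain C where C: "C \<ge> 0" and approx: "\<And>d b. b \<ge> 0 \<Longrightarrow> bounded_by b d \<Longrightarrow>
     \<exists>H. sq_integrable H \<and> (\<forall>t. t \<notin> S \<longrightarrow> H t = 0) \<and> energy H \<le> (C * b)\<^sup>2 \<and> bounded_by (\<theta> * b) (\<lambda>l. d l - fourier H l)"
  proof (rule approximate_interpolation[OF S \<Lambda> \<phi>(1,2,3) q(1) _ \<eta>])
    fix X y assume "finite X" "X \<subseteq> \<Lambda>" "y \<in> X"
    then show "(\<Sum>x\<in>X - {y}. norm (\<phi> (x - y))) \<le> q" by (rule q(3))
  next
    fix C assume "C \<ge> 0" and *: "\<And>c B. B \<ge> 0 \<Longrightarrow> (\<And>X. finite X \<Longrightarrow> X \<subseteq> \<Lambda> \<Longrightarrow> L2_set (\<lambda>l. norm (c l)) X \<le> B) \<Longrightarrow>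
       \<exists>H. sq_integrable H \<and> (\<forall>t. t \<notin> S \<longrightarrow> H t = 0) \<and> energy H \<le> (C * B)\<^sup>2 \<and>
         (\<forall>X. finite X \<longrightarrow> X \<subseteq> \<Lambda> \<longrightarrow> L2_set (\<lambda>l. norm (c l - fourier H l)) X \<le> (q + \<eta>) * B)"
    show thesis
    proof (rule that[OF \<open>C \<ge> 0\<close>])
      fix d b assume "b \<ge> 0" "bounded_by b d"
      then show "\<exists>H. sq_integrable H \<and> (\<forall>t. t \<notin> S \<longrightarrow> H t = 0) \<and> energy H \<le> (C * b)\<^sup>2 \<and> bounded_by (\<theta> * b) (\<lambda>l. d l - fourier H l)"
        using *[of b d] unfolding bounded_by_def \<theta>_def by blast
    qed
  qed
  define good where "good n d H \<longleftrightarrow> sq_integrable H \<and> (\<forall>t. t \<notin> S \<longrightarrow> H t = 0) \<and> energy H \<le> (C * (\<theta> ^ n * B))\<^sup>2 \<and>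
     bounded_by (\<theta> * (\<theta> ^ n * B)) (\<lambda>l. d l - fourier H l)" for n :: nat and d :: "'a \<Rightarrow> complex" and H
  have "\<exists>f. \<forall>n. (bounded_by (\<theta> ^ n * B) (f n) \<and> (n = 0 \<longrightarrow> f n = c)) \<and> (\<exists>H. good n (f n) H \<and> f (Suc n) = (\<lambda>l. f n l - fourier H l))"
  proof (rule dependent_nat_choice)
    show "\<exists>x. bounded_by (\<theta> ^ 0 * B) x \<and> (0 = (0::nat) \<longrightarrow> x = c)" using cB by auto
  next
    fix d and n :: nat assume d: "bounded_by (\<theta> ^ n * B) d \<and> (n = 0 \<longrightarrow> d = c)"
    have "\<theta> ^ n * B \<ge> 0" using \<theta> B0 by auto
    then obtain H where "good n d H" using approx[of "\<theta> ^ n * B" d] d unfolding good_def by blast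
    then show "\<exists>y. (bounded_by (\<theta> ^ Suc n * B) y \<and> (Suc n = 0 \<longrightarrow> y = c)) \<and> (\<exists>H. good n d H \<and> y = (\<lambda>l. d l - fourier H l))"
      by (intro exI[of _ "\<lambda>l. d l - fourier H l"]) (auto simp: good_def mult.assoc)
  qed
  then obtain f where f: "\<And>n. bounded_by (\<theta> ^ n * B) (f n)" "f 0 = c"
    and "\<forall>n. \<exists>H. good n (f n) H \<and> f (Suc n) = (\<lambda>l. f n l - fourier H l)" by blast
  then obtain H where H: "\<And>n. good n (f n) (H n)" and fS: "\<And>n. f (Suc n) = (\<lambda>l. f n l - fourier (H n) l)"
    by metis
  obtain G where G: "sq_integrable G" "\<And>t. t \<notin> S \<Longrightarrow> G t = 0" "\<And>x. (\<lambda>n. fourier (H n) x) sums fourier G x"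
  proof (rule sq_integrable_geometric_series[of S H "C * B" \<theta>])
    show "energy (H n) \<le> (C * B * \<theta> ^ n)\<^sup>2" for n using H[of n] by (simp add: good_def mult_ac)
  qed (use S H \<theta> in \<open>auto simp: good_def\<close>)
  have "fourier G l = c l" if l: "l \<in> \<Lambda>" for l
  proof -
    have part: "(\<Sum>k<n. fourier (H k) l) = c l - f n l" for n
      by (induction n) (simp_all add: f(2) fS)
    have "norm (f n l) \<le> \<theta> ^ n * B" for n
      using f(1)[of n] l unfolding bounded_by_def by (auto dest: spec[of _ "{l}"])
    moreover have "(\<lambda>n. \<theta> ^ n * B) \<longlonglongrightarrow> 0"
      using \<theta> by (intro tendsto_mult_left_zero LIMSEQ_realpow_zero) auto
    ultimately have "(\<lambda>n. f n l) \<longlonglongrightarrow> 0"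
      by (intro Lim_null_comparison[of "\<lambda>n. f n l"]) auto
    then have "(\<lambda>n. c l - f n l) \<longlonglongrightarrow> c l - 0" by (intro tendsto_intros)
    then have "(\<lambda>n. fourier (H n) l) sums c l"
      unfolding sums_def part by simp
    then show ?thesis using G(3) sums_unique2 by blast
  qed
  moreover have "fourier G \<in> paley_wiener S"
    unfolding paley_wiener_def using G(1,2) by auto
  ultimately show "\<exists>f\<in>paley_wiener S. \<forall>l\<in>\<Lambda>. f l = c l" by blast
qed

lemma symmetric_convex_body_contains_ball:
  fixes K :: "'a::euclidean_space set"
  assumes K: "convex_body K" "origin_symmetric K"
  obtains \<epsilon> where "\<epsilon> > 0" "ball 0 \<epsilon> \<subseteq> K"
proof -
  obtain x e where e: "e > 0" "ball x e \<subseteq> K"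
    using K(1) unfolding convex_body_def by (auto simp: mem_interior)
  have "y \<in> K" if "y \<in> ball 0 (e / 2)" for y
  proof -
    have "x + 2 *\<^sub>R y \<in> K" using that e by (intro subsetD[OF e(2)]) (simp add: dist_norm)
    moreover have "x \<in> K" using e by auto
    then have "- x \<in> K" using K(2) unfolding origin_symmetric_def by blast
    ultimately have "(1/2) *\<^sub>R (x + 2 *\<^sub>R y) + (1/2) *\<^sub>R (- x) \<in> K"
      using K(1) unfolding convex_body_def by (intro convexD) auto
    then show ?thesis by (simp add: scaleR_add_right)
  qed
  then have "ball 0 (e / 2) \<subseteq> K" by blast
  with e(1) show thesis using that[of "e / 2"] by simp
qed

text \<open>
  If \<open>x + 6 a = y + 6 b\<close>, then \<open>x - y\<close> is \<open>12\<close> times the midpoint of \<open>b\<close> and \<open>- a\<close>.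
\<close>

lemma packing_of_differences:
  fixes K :: "'a::euclidean_space set"
  assumes K: "convex K" "origin_symmetric K"
    and \<Lambda>: "{l - l' | l l'. l \<in> \<Lambda> \<and> l' \<in> \<Lambda>} \<inter> (\<lambda>x. 12 *\<^sub>R x) ` K = {0}"
  shows "packing ((\<lambda>x. 6 *\<^sub>R x) ` K) \<Lambda>"
  unfolding packing_def
proof (safe)
  fix x y a b assume xy: "x \<in> \<Lambda>" "y \<in> \<Lambda>" "x \<noteq> y" "a \<in> K" "b \<in> K" and e: "x + 6 *\<^sub>R a = y + 6 *\<^sub>R b"
  define m where "m = (1/2) *\<^sub>R b + (1/2) *\<^sub>R (- a)"
  have "m \<in> K" unfolding m_def using K xy by (intro convexD) (auto simp: origin_symmetric_def)
  moreover have "x - y = 12 *\<^sub>R m"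
  proof -
    have "x - y = 6 *\<^sub>R b - 6 *\<^sub>R a" using e by (simp add: algebra_simps)
    then show ?thesis by (simp add: m_def scaleR_diff_right)
  qed
  ultimately have "x - y \<in> {l - l' | l l'. l \<in> \<Lambda> \<and> l' \<in> \<Lambda>} \<inter> (\<lambda>x. 12 *\<^sub>R x) ` K"
    using xy(1,2) by blast
  then show False using \<Lambda> xy(3) by simp
qed

theorem theorem5p2:
  fixes S K :: "(real ^ 'n) set"
  assumes "CARD('n) > 1"
    and "convex_body S" and "origin_symmetric S"
    and "convex_body K" and "origin_symmetric K"
    and "admits_concentration S K"
  shows "\<forall>\<Lambda> :: (real ^ 'n) set.
    {l - l' | l l'. l \<in> \<Lambda> \<and> l' \<in> \<Lambda>} \<inter> (\<lambda>x. 12 *\<^sub>R x) ` K = {0} \<longrightarrow>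
    interpolation_set \<Lambda> (paley_wiener S)"
proof (intro allI impI)
  fix \<Lambda> :: "(real ^ 'n) set"
  assume \<Lambda>: "{l - l' | l l'. l \<in> \<Lambda> \<and> l' \<in> \<Lambda>} \<inter> (\<lambda>x. 12 *\<^sub>R x) ` K = {0}"
  have K: "convex K" and S: "bounded S"
    using assms(2,4) by (auto simp: convex_body_def intro: compact_imp_bounded)
  have p: "packing ((\<lambda>x. 6 *\<^sub>R x) ` K) \<Lambda>"
    by (rule packing_of_differences[OF K assms(5) \<Lambda>])
  obtain \<epsilon> where e: "\<epsilon> > 0" "ball 0 \<epsilon> \<subseteq> K"
    by (rule symmetric_convex_body_contains_ball[OF assms(4,5)], rule that)
  have "K \<subseteq> (\<lambda>x. 6 *\<^sub>R x) ` K"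
  proof
    fix x assume "x \<in> K"
    then have "(1/6) *\<^sub>R x \<in> K" by (intro symmetric_convex_scaleR[OF K assms(5)]) auto
    then show "x \<in> (\<lambda>x. 6 *\<^sub>R x) ` K" by (intro image_eqI[of _ _ "(1/6) *\<^sub>R x"]) auto
  qed
  then have pb: "packing (ball 0 \<epsilon>) \<Lambda>" using packing_mono[OF p] e(2) by blast
  obtain \<phi> :: "real ^ 'n \<Rightarrow> complex" where \<phi>: "bandlimited S \<phi>" "\<phi> 0 = 1" "\<And>x. norm (\<phi> (- x)) = norm (\<phi> x)"
    and small: "\<And>X y. finite X \<Longrightarrow> packing ((\<lambda>x. 6 *\<^sub>R x) ` K) X \<Longrightarrow> y \<in> X \<Longrightarrow>
       (\<Sum>x\<in>X - {y}. norm (\<phi> (x - y))) \<le> 64/73"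
    by (rule interpolation_kernel[OF assms(2-6)], rule that)
  show "interpolation_set \<Lambda> (paley_wiener S)"
  proof (rule interpolation_from_kernel[OF S pb e(1) \<phi>, of "64/73"])
    fix X y assume "finite X" "X \<subseteq> \<Lambda>" "y \<in> X"
    then show "(\<Sum>x\<in>X - {y}. norm (\<phi> (x - y))) \<le> 64/73"
      using packing_subset[OF p] by (intro small)
  qed auto
qed

end
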